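(* Let $\mathcal{B}$ be an admissible Banach space of analytic functions on $\mathbb{D}$ (defined in the context). (a) If $\mathcal{B}$ has boundary-extension type $0$, then a closed, finite-codimensional subspace $\mathcal{N}$ of $\mathcal{B}$ is $M_z$-invariant if and only if $\mathcal{N}$ is the range of a Fredholm multiplication operator on $\mathcal{B}$. (b) If $\mathcal{B}$ has positive boundary-extension type, then every closed, finite-codimensional subspace $\mathcal{N}$ of $\mathcal{B}$ that is $M_z$-invariant is either the range of a Fredholm multiplication operator having polynomial symbol necessarily bounded away from $0$ near $\partial\mathbb{D}$, or the closure of the range of a multiplication operator having polynomial symbol that is not bounded away from $0$ near $\partial\mathbb{D}$.
   Context: $\mathbb{D}$ is the open unit disk in $\mathbb{C}$, $\mathbb{D}^-$ its closure, $H(\mathbb{D})$ the holomorphic functions on $\mathbb{D}$. For a Banach space $B\subset H(\mathbb{D})$ with continuous point evaluations, $\psi\in H(\mathbb{D})$ is a multiplier of $B$ if $\psi g\in B$ for all $g\in B$; then the multiplication operator with symbol $\psi$ is $M_\psi:B\to B$, $M_\psi g=\psi g$ (also written $M_{\psi(z)}$; $M_z$ is multiplication by the identity function). An operator is Fredholm if it is bounded and linear with finite-dimensional kernel and closed, finite-codimensional range. A function $\psi\in H(\mathbb{D})$ is bounded away from $0$ near $\partial\mathbb{D}$ if there are $\epsilon>0$ and $0<r<1$ with $|\psi(z)|>\epsilon$ whenever $r<|z|<1$. $C^k(\mathbb{D}^-)$ is the space of functions continuously differentiable on $\mathbb{D}^-$ through order $k$; $B\subset C^k(\mathbb{D}^-)$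 means that each $f\in B$ extends to a function (also denoted $f$) in $C^k(\mathbb{D}^-)$. Boundary-extension type: let $B\subset H(\mathbb{D})$ be a Banach space with $M_z:B\to B$ bounded and point evaluations at points of $\mathbb{D}$ continuous. For a positive integer $n$, $B$ has boundary-extension type $n$ if $B\subset C^{n-1}(\mathbb{D}^-)$ and, for each $\zeta\in\partial\mathbb{D}$, the closure of the range of $M_{(z-\zeta)^{n+1}}:B\to B$ contains the function $(z-\zeta)^n$. $B$ has boundary-extension type $0$ if, for each $\zeta\in\partial\mathbb{D}$, the closure of the range of $M_{z-\zeta}:B\to B$ contains the constant function $1$. Positive boundary-extension type means type $n$ for some positive integer $n$. An admissible space is a Banach space $\mathcal{B}$ of analytic functions on $\mathbb{D}$ such that: (i) $\mathcal{B}$ contains the polynomials as a dense subspace; (ii) for each $z\in\mathbb{D}$ the functional $E_z:f\mapsto f(z)$ is continuous on $\mathcal{B}$; (iii) $M_z:\mathcal{B}\to\mathcal{B}$ is bounded and has spectral radius $1$; (iv) if $q$ is a polynomial all of whose zeros lie in $\mathbb{D}$ and $qf\in\mathcal{B}$ for some $f\in H(\mathbb{D})$, then $f\in\mathcal{B}$; (v) if $g$ is a multiplier of $\mathcal{B}$ that is bounded away from $0$ on $\mathbb{D}$, then $1/g$ is a multiplier of $\mathcal{B}$; (vi) for each positive integer $l$, if $q_k(z)=\sum_{j=0}^l a_{j,k}z^j$ are polynomials with $a_{j,k}\to0$ as $k\to\infty$ for each $j\in\{0,\dots,l\}$, then $q_k\to0$ in $\mathcal{B}$; (vii) $\mathcal{B}$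 has boundary-extension type $n$ for some nonnegative integer $n$. *)

theory Defs
  imports "HOL-Analysis.Analysis" "HOL-Computational_Algebra.Polynomial"
    "HOL-Library.Function_Algebras"
begin

text \<open>
  A function on the open unit disk is represented by the total function that agrees with it on
  the disk and is \<open>0\<close> elsewhere, so that equality on the disk is equality in HOL. Sums and
  products of functions are the pointwise ones of \<^theory>\<open>HOL-Library.Function_Algebras\<close>.
\<close>

type_synonym cfun = "complex \<Rightarrow> complex"

abbreviation unit_disk :: "complex set" where
  "unit_disk \<equiv> ball 0 1"

definition on_disk :: "cfun \<Rightarrow> cfun" where
  "on_disk f = (\<lambda>z. if z \<in> unit_disk then f z else 0)"

definition hol_disk :: "cfun set" where
  "hol_disk = {f. f holomorphic_on unit_disk \<and> (\<forall>z. z \<notin> unit_disk \<longrightarrow> f z = 0)}"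

definition cscale :: "complex \<Rightarrow> cfun \<Rightarrow> cfun" where
  "cscale c f = (\<lambda>z. c * f z)"

global_interpretation cfun: vector_space cscale
  by unfold_locales (auto simp: cscale_def fun_eq_iff algebra_simps)


text \<open>
  A space of functions is given by its carrier \<open>B\<close> and its norm \<open>nrm\<close>; only the values of
  \<open>nrm\<close> on \<open>B\<close> are meaningful. The guard makes the distance nonnegative and symmetric on the
  whole type, which the locale \<^locale>\<open>Metric_space\<close> requires.
\<close>

definition norm_dist :: "cfun set \<Rightarrow> (cfun \<Rightarrow> real) \<Rightarrow> cfun \<Rightarrow> cfun \<Rightarrow> real" where
  "norm_dist B nrm f g = (if f \<in> B \<and> g \<in> B then nrm (f - g) else 0)"

definition norm_top :: "cfun set \<Rightarrow> (cfun \<Rightarrow> real) \<Rightarrow> cfun topology" where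
  "norm_top B nrm = Metric_space.mtopology B (norm_dist B nrm)"

definition banach_space_on :: "cfun set \<Rightarrow> (cfun \<Rightarrow> real) \<Rightarrow> bool" where
  "banach_space_on B nrm \<longleftrightarrow>
     cfun.subspace B \<and>
     (\<forall>f\<in>B. 0 \<le> nrm f \<and> (nrm f = 0 \<longleftrightarrow> f = 0)) \<and>
     (\<forall>f\<in>B. \<forall>c. nrm (cscale c f) = cmod c * nrm f) \<and>
     (\<forall>f\<in>B. \<forall>g\<in>B. nrm (f + g) \<le> nrm f + nrm g) \<and>
     Metric_space.mcomplete B (norm_dist B nrm)"

definition bounded_operator :: "cfun set \<Rightarrow> (cfun \<Rightarrow> real) \<Rightarrow> (cfun \<Rightarrow> cfun) \<Rightarrow> bool" where
  "bounded_operator B nrm T \<longleftrightarrow>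
     T ` B \<subseteq> B \<and>
     (\<forall>f\<in>B. \<forall>g\<in>B. T (f + g) = T f + T g) \<and>
     (\<forall>f\<in>B. \<forall>c. T (cscale c f) = cscale c (T f)) \<and>
     (\<exists>K. \<forall>f\<in>B. nrm (T f) \<le> K * nrm f)"

definition op_spectrum :: "cfun set \<Rightarrow> (cfun \<Rightarrow> real) \<Rightarrow> (cfun \<Rightarrow> cfun) \<Rightarrow> complex set" where
  "op_spectrum B nrm T =
     {l. \<not> (\<exists>S. bounded_operator B nrm S \<and>
              (\<forall>f\<in>B. S (T f - cscale l f) = f \<and> T (S f) - cscale l (S f) = f))}"

text \<open>The supremum is taken in the extended reals, so that it always exists.\<close>

definition op_spectral_radius :: "cfun set \<Rightarrow> (cfun \<Rightarrow> real) \<Rightarrow> (cfun \<Rightarrow> cfun) \<Rightarrow> ereal" where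
  "op_spectral_radius B nrm T = (SUP l\<in>op_spectrum B nrm T. ereal (cmod l))"

definition finite_dimensional :: "cfun set \<Rightarrow> bool" where
  "finite_dimensional V \<longleftrightarrow> (\<exists>F. finite F \<and> cfun.span F = V)"

definition finite_codimensional :: "cfun set \<Rightarrow> cfun set \<Rightarrow> bool" where
  "finite_codimensional B N \<longleftrightarrow>
     cfun.subspace N \<and> N \<subseteq> B \<and> (\<exists>F. finite F \<and> cfun.span (N \<union> F) = B)"

definition fredholm :: "cfun set \<Rightarrow> (cfun \<Rightarrow> real) \<Rightarrow> (cfun \<Rightarrow> cfun) \<Rightarrow> bool" where
  "fredholm B nrm T \<longleftrightarrow>
     bounded_operator B nrm T \<and>
     finite_dimensional {f \<in> B. T f = 0} \<and>
     closedin (norm_top B nrm) (T ` B) \<and>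
     finite_codimensional B (T ` B)"


text \<open>
  For a multiplier \<open>\<psi>\<close>, the operator of multiplication by \<open>\<psi>\<close> is the section \<open>(*) \<psi>\<close>. Since
  members of \<open>B\<close> vanish off the disk, only the values of \<open>\<psi>\<close> on the disk matter, and a symbol
  need not itself vanish off the disk.
\<close>

definition multiplier :: "cfun set \<Rightarrow> cfun \<Rightarrow> bool" where
  "multiplier B \<psi> \<longleftrightarrow> \<psi> holomorphic_on unit_disk \<and> (\<forall>g\<in>B. \<psi> * g \<in> B)"

definition bounded_away_on_disk :: "cfun \<Rightarrow> bool" where
  "bounded_away_on_disk \<psi> \<longleftrightarrow> (\<exists>\<epsilon>>0. \<forall>z\<in>unit_disk. cmod (\<psi> z) > \<epsilon>)"

definition bounded_away_near_boundary :: "cfun \<Rightarrow> bool" where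
  "bounded_away_near_boundary \<psi> \<longleftrightarrow>
     (\<exists>\<epsilon>>0. \<exists>r. 0 < r \<and> r < 1 \<and> (\<forall>z. r < cmod z \<and> cmod z < 1 \<longrightarrow> cmod (\<psi> z) > \<epsilon>))"

text \<open>
  \<open>Ck_closed_disk k\<close> consists of the functions with \<open>k\<close> continuous complex derivatives on the
  closed disk, derivatives at boundary points being taken relative to the closed disk; \<open>G j\<close> is
  the \<open>j\<close>-th derivative. Only extensions of holomorphic functions are of interest, and for those
  complex and real differentiability through order \<open>k\<close> agree.
\<close>

definition Ck_closed_disk :: "nat \<Rightarrow> cfun set" where
  "Ck_closed_disk k =
     {g. \<exists>G :: nat \<Rightarrow> cfun. G 0 = g \<and>
         (\<forall>j<k. \<forall>z\<in>cball 0 1. (G j has_field_derivative G (Suc j) z) (at z within cball 0 1)) \<and>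
         (\<forall>j\<le>k. continuous_on (cball 0 1) (G j))}"

definition extends_to_Ck :: "nat \<Rightarrow> cfun \<Rightarrow> bool" where
  "extends_to_Ck k f \<longleftrightarrow> (\<exists>g\<in>Ck_closed_disk k. \<forall>z\<in>unit_disk. g z = f z)"

text \<open>
  For \<open>n = 0\<close> the second condition says that the closure of the range of multiplication by
  \<open>z - \<zeta>\<close> contains the constant function \<open>1\<close>.
\<close>

definition boundary_extension_type :: "cfun set \<Rightarrow> (cfun \<Rightarrow> real) \<Rightarrow> nat \<Rightarrow> bool" where
  "boundary_extension_type B nrm n \<longleftrightarrow>
     (n > 0 \<longrightarrow> (\<forall>f\<in>B. extends_to_Ck (n - 1) f)) \<and>
     (\<forall>\<zeta>\<in>sphere 0 1. on_disk (\<lambda>z. (z - \<zeta>) ^ n) \<in>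
        norm_top B nrm closure_of ((*) (\<lambda>z. (z - \<zeta>) ^ (n + 1)) ` B))"

definition admissible_space :: "cfun set \<Rightarrow> (cfun \<Rightarrow> real) \<Rightarrow> bool" where
  "admissible_space B nrm \<longleftrightarrow>
     B \<subseteq> hol_disk \<and> banach_space_on B nrm \<and>
     \<comment> \<open>(i)\<close>
     range (\<lambda>p. on_disk (poly p)) \<subseteq> B \<and>
     norm_top B nrm closure_of range (\<lambda>p. on_disk (poly p)) = B \<and>
     \<comment> \<open>(ii)\<close>
     (\<forall>z\<in>unit_disk. continuous_map (norm_top B nrm) euclidean (\<lambda>f. f z)) \<and>
     \<comment> \<open>(iii)\<close>
     bounded_operator B nrm ((*) (\<lambda>z. z)) \<and>
     op_spectral_radius B nrm ((*) (\<lambda>z. z)) = 1 \<and>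
     \<comment> \<open>(iv)\<close>
     (\<forall>q. (\<forall>z. poly q z = 0 \<longrightarrow> z \<in> unit_disk) \<longrightarrow>
        (\<forall>f\<in>hol_disk. poly q * f \<in> B \<longrightarrow> f \<in> B)) \<and>
     \<comment> \<open>(v)\<close>
     (\<forall>g. multiplier B g \<and> bounded_away_on_disk g \<longrightarrow> multiplier B (\<lambda>z. 1 / g z)) \<and>
     \<comment> \<open>(vi)\<close>
     (\<forall>l>0. \<forall>a :: nat \<Rightarrow> nat \<Rightarrow> complex.
        (\<forall>j\<le>l. (\<lambda>k. a j k) \<longlonglongrightarrow> 0) \<longrightarrow>
        (\<lambda>k. nrm (on_disk (\<lambda>z. \<Sum>j\<le>l. a j k * z ^ j))) \<longlonglongrightarrow> 0) \<and>
     \<comment> \<open>(vii)\<close>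
     (\<exists>n. boundary_extension_type B nrm n)"

end

theory Submission
  imports Defs "HOL-Complex_Analysis.Complex_Analysis"
begin

text \<open>
  Let \<open>p\<close> be a nonzero polynomial of least degree \<open>d\<close> in \<open>N\<close>. The sum of the closure of \<open>p B\<close> and the
  polynomials of degree below \<open>d\<close> is closed, because only finitely many dimensions are added, and it
  contains all polynomials, so it is \<open>B\<close>; as no nonzero polynomial of degree below \<open>d\<close> lies in \<open>N\<close>,
  \<open>N\<close> is the closure of \<open>p B\<close>. A factor \<open>z - a\<close> of \<open>p\<close> that is invertible on \<open>B\<close>, or whose range is dense,
  could be cancelled, contradicting minimality; this excludes zeros outside the closed disk and, for
  type \<open>0\<close>, zeros on the circle. If all zeros lie in the open disk, division with remainder in \<open>B\<close>
  gives \<open>N = p B\<close>. Conversely, if \<open>p B\<close> is closed of finite codimension and \<open>p\<close> vanishes at a boundary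
  point, then \<open>B\<close> splits as \<open>(z - \<zeta>) B\<close> plus constants, which positive type excludes.
\<close>

subsection \<open>Closed subspaces and uniform boundedness\<close>

locale banach_cfuns =
  fixes B :: "cfun set" and nrm :: "cfun \<Rightarrow> real"
  assumes banach: "banach_space_on B nrm"
begin

lemma subspace_B: "cfun.subspace B"
  using banach by (simp add: banach_space_on_def)

lemmas zero_mem = cfun.subspace_0[OF subspace_B]
  and add_mem = cfun.subspace_add[OF subspace_B]
  and diff_mem = cfun.subspace_diff[OF subspace_B]
  and scale_mem = cfun.subspace_scale[OF subspace_B]

lemma nrm_nonneg: "f \<in> B \<Longrightarrow> 0 \<le> nrm f"
  and nrm_eq_0_iff: "f \<in> B \<Longrightarrow> nrm f = 0 \<longleftrightarrow> f = 0"
  and nrm_scale: "f \<in> B \<Longrightarrow> nrm (cscale c f) = cmod c * nrm f"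
  and nrm_triangle: "f \<in> B \<Longrightarrow> g \<in> B \<Longrightarrow> nrm (f + g) \<le> nrm f + nrm g"
  and complete_B: "Metric_space.mcomplete B (norm_dist B nrm)"
  using banach by (simp_all add: banach_space_on_def)

lemma nrm_0: "nrm 0 = 0"
  using nrm_eq_0_iff zero_mem by blast

lemma nrm_minus_commute:
  assumes "f \<in> B" "g \<in> B" shows "nrm (f - g) = nrm (g - f)"
proof -
  have "f - g = cscale (-1) (g - f)" by (auto simp: cscale_def fun_eq_iff)
  then show ?thesis using nrm_scale[of "g - f" "-1"] assms diff_mem by simp
qed

lemma nrm_triangle_diff:
  assumes "f \<in> B" "g \<in> B" "h \<in> B" shows "nrm (f - h) \<le> nrm (f - g) + nrm (g - h)"
  using nrm_triangle[of "f - g" "g - h"] assms diff_mem by simp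

text \<open>Brings in the metric-space facts, among them the Baire category theorem behind uniform
  boundedness.\<close>

sublocale Metric_space B "norm_dist B nrm"
proof
  show "0 \<le> norm_dist B nrm x y" for x y
    by (simp add: norm_dist_def nrm_nonneg diff_mem)
  show "norm_dist B nrm x y = norm_dist B nrm y x" for x y
    by (simp add: norm_dist_def nrm_minus_commute)
  show "norm_dist B nrm x y = 0 \<longleftrightarrow> x = y" if "x \<in> B" "y \<in> B" for x y
    using that by (simp add: norm_dist_def nrm_eq_0_iff diff_mem)
  show "norm_dist B nrm x z \<le> norm_dist B nrm x y + norm_dist B nrm y z"
    if "x \<in> B" "y \<in> B" "z \<in> B" for x y z
    using that by (simp add: norm_dist_def nrm_triangle_diff)
qed

lemma topspace_norm_top: "topspace (norm_top B nrm) = B"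
  by (simp add: norm_top_def)

lemma in_closure_iff:
  "f \<in> norm_top B nrm closure_of S \<longleftrightarrow> f \<in> B \<and> (\<forall>e>0. \<exists>g\<in>S. g \<in> B \<and> nrm (f - g) < e)"
  unfolding norm_top_def metric_closure_of by (auto simp: norm_dist_def)

lemma in_closureD:
  assumes "f \<in> norm_top B nrm closure_of S" "e > 0"
  obtains g where "g \<in> S" "g \<in> B" "nrm (f - g) < e"
  using assms in_closure_iff by blast

lemma closed_limit:
  assumes "closedin (norm_top B nrm) N" "f \<in> B" "\<And>e. e > 0 \<Longrightarrow> \<exists>g\<in>N. nrm (f - g) < e"
  shows "f \<in> N"
proof -
  have "N \<subseteq> B" using closedin_subset[OF assms(1)] topspace_norm_top by simp
  then have "f \<in> norm_top B nrm closure_of N"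
    unfolding in_closure_iff using assms by blast
  then show ?thesis using closure_of_closedin[OF assms(1)] by simp
qed

lemma subspace_closure:
  assumes "cfun.subspace W" "W \<subseteq> B"
  shows "cfun.subspace (norm_top B nrm closure_of W)"
proof (rule cfun.subspaceI)
  have "W \<subseteq> norm_top B nrm closure_of W"
    using assms(2) by (simp add: closure_of_subset topspace_norm_top)
  then show "0 \<in> norm_top B nrm closure_of W" using cfun.subspace_0[OF assms(1)] by blast
next
  fix f g assume fg: "f \<in> norm_top B nrm closure_of W" "g \<in> norm_top B nrm closure_of W"
  then have B: "f \<in> B" "g \<in> B" by (auto simp: in_closure_iff)
  have "\<exists>h\<in>W. h \<in> B \<and> nrm (f + g - h) < e" if "e > 0" for e
  proof -
    obtain f' where f': "f' \<in> W" "f' \<in> B" "nrm (f - f') < e/2"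
      using in_closureD[OF fg(1) half_gt_zero[OF \<open>e > 0\<close>]] by blast
    obtain g' where g': "g' \<in> W" "g' \<in> B" "nrm (g - g') < e/2"
      using in_closureD[OF fg(2) half_gt_zero[OF \<open>e > 0\<close>]] by blast
    have "nrm ((f - f') + (g - g')) < e"
      using nrm_triangle[of "f - f'" "g - g'"] f' g' B diff_mem by fastforce
    then have "nrm (f + g - (f' + g')) < e" by (simp add: algebra_simps)
    then show ?thesis using cfun.subspace_add[OF assms(1) f'(1) g'(1)] add_mem[OF f'(2) g'(2)] by blast
  qed
  then show "f + g \<in> norm_top B nrm closure_of W"
    using B add_mem by (auto simp: in_closure_iff)
next
  fix c f assume f: "f \<in> norm_top B nrm closure_of W"
  then have B: "f \<in> B" by (auto simp: in_closure_iff)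
  have "\<exists>h\<in>W. h \<in> B \<and> nrm (cscale c f - h) < e" if "e > 0" for e
  proof -
    have pos: "e / (cmod c + 1) > 0"
      using that by (simp add: add_nonneg_pos)
    obtain f' where f': "f' \<in> W" "f' \<in> B" "nrm (f - f') < e / (cmod c + 1)"
      using in_closureD[OF f pos] by auto
    have "nrm (cscale c (f - f')) = cmod c * nrm (f - f')"
      using nrm_scale f' B diff_mem by simp
    also have "\<dots> \<le> (cmod c + 1) * nrm (f - f')"
      using nrm_nonneg f' B diff_mem by (simp add: mult_right_mono)
    also have "\<dots> < e"
      using f'(3) by (simp add: pos_less_divide_eq add_nonneg_pos mult.commute)
    finally have "nrm (cscale c f - cscale c f') < e"
      by (simp add: cfun.scale_right_diff_distrib)
    then show ?thesis
      using cfun.subspace_scale[OF assms(1)] f' scale_mem by blast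
  qed
  then show "cscale c f \<in> norm_top B nrm closure_of W"
    using B scale_mem by (auto simp: in_closure_iff)
qed

text \<open>If \<open>x\<close> is outside \<open>N\<close>, it has positive distance from
  \<open>N\<close>, so the coefficient of \<open>x\<close> is controlled by the norm of the sum.
  Along a convergent sequence the coefficients then converge, and so do the parts in
  \<open>N\<close>.\<close>

lemma closed_add_line:
  assumes closed: "closedin (norm_top B nrm) N" and sub: "cfun.subspace N" and x: "x \<in> B"
  shows "closedin (norm_top B nrm) {n + cscale c x | n c. n \<in> N}"
proof (cases "x \<in> N")
  case True
  have "{n + cscale c x | n c. n \<in> N} = N"
  proof safe
    show "n + cscale c x \<in> N" if "n \<in> N" for n c
      using that True sub cfun.subspace_add cfun.subspace_scale by blast
    show "\<exists>n' c. n = n' + cscale c x \<and> n' \<in> N" if "n \<in> N" for n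
      using that by (intro exI[of _ n] exI[of _ 0]) auto
  qed
  then show ?thesis using closed by simp
next
  case False
  have NB: "N \<subseteq> B" using closedin_subset[OF closed] topspace_norm_top by simp
  let ?W = "{n + cscale c x | n c. n \<in> N}"
  have WB: "?W \<subseteq> B" using NB x add_mem scale_mem by auto
  obtain d where d: "d > 0" "\<And>n. n \<in> N \<Longrightarrow> d \<le> nrm (x - n)"
    using closed_limit[OF closed x] False by (meson not_le)
  have coef: "cmod c * d \<le> nrm (n + cscale c x)" if "n \<in> N" for n c
  proof (cases "c = 0")
    case True
    then show ?thesis using that NB nrm_nonneg by auto
  next
    case c: False
    \<comment> \<open>Scaling by \<open>1 / c\<close> turns \<open>n + cscale c x\<close> into a
      difference between \<open>x\<close> and a point of \<open>N\<close>.\<close>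
    have mem: "cscale (- 1 / c) n \<in> N" using that sub cfun.subspace_scale by blast
    have eq: "cscale c (x - cscale (- 1 / c) n) = n + cscale c x"
      using c by (auto simp: cscale_def fun_eq_iff field_simps)
    have "cmod c * d \<le> cmod c * nrm (x - cscale (- 1 / c) n)"
      using d(2)[OF mem] by (simp add: mult_left_mono)
    also have "\<dots> = nrm (cscale c (x - cscale (- 1 / c) n))"
      using nrm_scale mem NB x diff_mem by (metis subsetD)
    finally show ?thesis unfolding eq .
  qed
  have "f \<in> ?W" if f: "f \<in> norm_top B nrm closure_of ?W" for f
  proof -
    have fB: "f \<in> B" using f by (simp add: in_closure_iff)
    have "\<exists>n c. n \<in> N \<and> nrm (f - (n + cscale c x)) < e" if "e > 0" for e
    proof -
      have "\<exists>g\<in>?W. g \<in> B \<and> nrm (f - g) < e"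
        using f[unfolded in_closure_iff] that by simp
      then show ?thesis by auto
    qed
    then have "\<exists>n c. n \<in> N \<and> nrm (f - (n + cscale c x)) < inverse (real (Suc k))" for k
      by simp
    then obtain n c where nc: "\<And>k. n k \<in> N"
        "\<And>k. nrm (f - (n k + cscale (c k) x)) < inverse (real (Suc k))"
      by metis
    have mem: "n k + cscale (c k) x \<in> B" for k using nc(1) WB by blast
    \<comment> \<open>Differences of approximants again have the form \<open>n + cscale c x\<close>,
      so \<open>coef\<close> passes the Cauchy property from their norms to the
      coefficients.\<close>
    have "Cauchy c"
    proof (rule CauchyI)
      fix e :: real assume "e > 0"
      then obtain K where K: "inverse (real (Suc K)) < e * d / 2"
        using reals_Archimedean[of "e * d / 2"] d(1) by auto
      have "cmod (c k - c l) < e" if "k \<ge> K" "l \<ge> K" for k l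
      proof -
        have eq: "(n k - n l) + cscale (c k - c l) x
            = (n k + cscale (c k) x) - (n l + cscale (c l) x)"
          by (auto simp: cscale_def fun_eq_iff algebra_simps)
        have "cmod (c k - c l) * d \<le> nrm ((n k + cscale (c k) x) - (n l + cscale (c l) x))"
          using coef[OF cfun.subspace_diff[OF sub nc(1) nc(1)], of "c k - c l" k l]
          unfolding eq .
        also have "\<dots> \<le> nrm (n k + cscale (c k) x - f) + nrm (f - (n l + cscale (c l) x))"
          using nrm_triangle_diff mem fB by simp
        also have "\<dots> < inverse (real (Suc k)) + inverse (real (Suc l))"
          using nc(2)[of k] nc(2)[of l] nrm_minus_commute[OF mem fB] by simp
        also have "\<dots> \<le> inverse (real (Suc K)) + inverse (real (Suc K))"
          using that by (intro add_mono le_imp_inverse_le) auto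
        also have "\<dots> < e * d" using K by simp
        finally show ?thesis using d(1) by simp
      qed
      then show "\<exists>M. \<forall>m\<ge>M. \<forall>n\<ge>M. norm (c m - c n) < e" by blast
    qed
    then obtain c0 where c0: "c \<longlonglongrightarrow> c0"
      using Cauchy_convergent convergent_def by blast
    have fx: "f - cscale c0 x \<in> B" using fB x diff_mem scale_mem by blast
    \<comment> \<open>Once the limit coefficient is subtracted, the parts \<open>n k\<close>
      approximate the rest, and closedness of \<open>N\<close> applies.\<close>
    have "f - cscale c0 x \<in> N"
    proof (rule closed_limit[OF closed fx])
      fix e :: real assume e: "e > 0"
      have "(\<lambda>k. inverse (real (Suc k)) + cmod (c k - c0) * nrm x) \<longlonglongrightarrow> 0 + cmod (c0 - c0) * nrm x"
        by (intro tendsto_intros LIMSEQ_inverse_real_of_nat c0)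
      then have "eventually (\<lambda>k. inverse (real (Suc k)) + cmod (c k - c0) * nrm x < e) sequentially"
        using e by (intro order_tendstoD) auto
      then obtain k where k: "inverse (real (Suc k)) + cmod (c k - c0) * nrm x < e"
        using eventually_happens'[OF sequentially_bot] by blast
      have eq: "f - cscale c0 x - n k = (f - (n k + cscale (c k) x)) + cscale (c k - c0) x"
        by (auto simp: cscale_def fun_eq_iff algebra_simps)
      have "nrm (f - cscale c0 x - n k) \<le> nrm (f - (n k + cscale (c k) x)) + nrm (cscale (c k - c0) x)"
        unfolding eq using nrm_triangle fB mem x diff_mem scale_mem by simp
      also have "\<dots> < e" using nc(2)[of k] k nrm_scale[OF x] by simp
      finally show "\<exists>g\<in>N. nrm (f - cscale c0 x - g) < e" using nc(1) by blast
    qed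
    moreover have "f = (f - cscale c0 x) + cscale c0 x" by simp
    ultimately show ?thesis by blast
  qed
  then have "norm_top B nrm closure_of ?W \<subseteq> ?W" by blast
  then show ?thesis
    using closure_of_subset_eq[of ?W "norm_top B nrm"] WB topspace_norm_top by simp
qed

text \<open>Banach-Steinhaus theorem. The open sets \<open>U m\<close> where some
  \<open>\<phi> k\<close> exceeds \<open>m\<close> have empty intersection, as convergent sequences
  are bounded. By Baire one of them is not dense, and all \<open>\<phi> k\<close> are bounded by
  \<open>m\<close> on a ball that it misses.\<close>

lemma bounded_functional_pointwise_limit:
  assumes linear: "\<And>k::nat. \<And>f g. f \<in> B \<Longrightarrow> g \<in> B \<Longrightarrow> \<phi> k (f - g) = \<phi> k f - \<phi> k g"
      "\<And>k f c. f \<in> B \<Longrightarrow> \<phi> k (cscale c f) = c * \<phi> k f"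
    and bounded: "\<And>k. \<exists>K. \<forall>f\<in>B. cmod (\<phi> k f) \<le> K * nrm f"
    and lim: "\<And>f. f \<in> B \<Longrightarrow> (\<lambda>k. \<phi> k f) \<longlonglongrightarrow> \<Phi> f"
  shows "\<exists>K. \<forall>f\<in>B. cmod (\<Phi> f) \<le> K * nrm f"
proof -
  define U where "U m = {f\<in>B. \<exists>k. cmod (\<phi> k f) > real m}" for m :: nat
  have U_open: "openin mtopology (U m)" for m
    unfolding openin_mtopology
  proof (intro conjI allI impI)
    show "U m \<subseteq> B" by (auto simp: U_def)
    fix f assume "f \<in> U m"
    then obtain k where f: "f \<in> B" and k: "cmod (\<phi> k f) > real m" by (auto simp: U_def)
    obtain K where K: "\<And>g. g \<in> B \<Longrightarrow> cmod (\<phi> k g) \<le> K * nrm g" using bounded by blast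
    \<comment> \<open>\<open>K\<close> may be zero or negative; \<open>\<bar>K\<bar> + 1\<close> is
      a positive Lipschitz constant for \<open>\<phi> k\<close>.\<close>
    define r where "r = (cmod (\<phi> k f) - real m) / (\<bar>K\<bar> + 1)"
    have r: "r > 0" using k by (simp add: r_def divide_pos_pos)
    have "g \<in> U m" if "g \<in> mball f r" for g
    proof -
      have g: "g \<in> B" "nrm (f - g) < r" using that f by (auto simp: norm_dist_def)
      have "cmod (\<phi> k f) - cmod (\<phi> k g) \<le> cmod (\<phi> k (f - g))"
        unfolding linear(1)[OF f g(1)] by (rule norm_triangle_ineq2)
      also have "\<dots> \<le> K * nrm (f - g)" using K f g diff_mem by blast
      also have "\<dots> \<le> (\<bar>K\<bar> + 1) * nrm (f - g)"
        using nrm_nonneg f g diff_mem by (intro mult_right_mono) auto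
      also have "\<dots> < (\<bar>K\<bar> + 1) * r" using g by (intro mult_strict_left_mono) auto
      also have "\<dots> = cmod (\<phi> k f) - real m" by (simp add: r_def)
      finally show ?thesis using g by (auto simp: U_def)
    qed
    then show "\<exists>r>0. mball f r \<subseteq> U m" using r by blast
  qed
  have empty: "\<Inter>(range U) = {}"
  proof (rule equals0I)
    fix f assume f: "f \<in> \<Inter>(range U)"
    then have "f \<in> B" by (auto simp: U_def)
    then have "Bseq (\<lambda>k. \<phi> k f)" using lim convergentI convergent_imp_Bseq by blast
    then obtain C where C: "\<And>k. cmod (\<phi> k f) \<le> C" unfolding Bseq_def by blast
    obtain m where "C < real m" using reals_Archimedean2 by blast
    moreover obtain k where "cmod (\<phi> k f) > real m" using f by (auto simp: U_def)
    ultimately show False using C[of k] by simp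
  qed
  have "\<exists>m. mtopology closure_of (U m) \<noteq> B"
  proof (rule ccontr)
    assume "\<nexists>m. mtopology closure_of (U m) \<noteq> B"
    then have "mtopology closure_of \<Inter>(range U) = B"
      using complete_B U_open by (intro metric_Baire_category) auto
    then show False using empty zero_mem by auto
  qed
  then obtain m f0 where f0: "f0 \<in> B" "f0 \<notin> mtopology closure_of (U m)"
    using closure_of_subset_topspace[of mtopology] by auto
  then obtain r where r: "r > 0" "\<And>f. f \<in> U m \<Longrightarrow> f \<notin> mball f0 r"
    using metric_closure_of by auto
  have small: "cmod (\<phi> k f) \<le> real m" if "f \<in> B" "nrm (f0 - f) < r" for f k
    proof -
    have "f \<in> mball f0 r" using that f0(1) by (simp add: norm_dist_def)
    then have "f \<notin> U m" using r(2) by blast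
    then show ?thesis using that(1) by (auto simp: U_def not_less)
  qed
  have unit: "cmod (\<phi> k f) \<le> 2 * real m" if f: "f \<in> B" "nrm f < r" for f k
  proof -
    \<comment> \<open>Moves the bound from the ball around \<open>f0\<close> to the one around
      \<open>0\<close>: both \<open>f0\<close> and \<open>f0 - f\<close> lie in the former.\<close>
    have "f0 - (f0 - f) = f" by simp
    then have "cmod (\<phi> k (f0 - f)) \<le> real m" using small[of "f0 - f"] f f0 diff_mem by simp
    moreover have "cmod (\<phi> k f0) \<le> real m" using small[of f0] f0 r nrm_0 by simp
    moreover have "\<phi> k f = \<phi> k f0 - \<phi> k (f0 - f)" using linear(1) f f0 by simp
    ultimately show ?thesis using norm_triangle_ineq4[of "\<phi> k f0" "\<phi> k (f0 - f)"] by simp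
  qed
  have "cmod (\<phi> k f) \<le> (4 * real m / r) * nrm f" if f: "f \<in> B" for f k
  proof (cases "f = 0")
    case True
    then show ?thesis using linear(2)[OF zero_mem, of k 0] nrm_0 by simp
  next
    case False
    then have pos: "nrm f > 0" using nrm_nonneg nrm_eq_0_iff f by (metis order_le_less)
    \<comment> \<open>The factor 2 places the rescaled vector strictly inside the ball, where
      \<open>unit\<close> applies.\<close>
    define t where "t = r / (2 * nrm f)"
    have t: "t > 0" "t * nrm f < r" using pos r by (auto simp: t_def)
    have "cmod (\<phi> k (cscale (of_real t) f)) \<le> 2 * real m"
      using unit f scale_mem nrm_scale t by simp
    then have "t * cmod (\<phi> k f) \<le> 2 * real m"
      using linear(2)[OF f] t by (simp add: norm_mult)
    then show ?thesis using pos r by (simp add: t_def field_simps)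
  qed
  \<comment> \<open>The constant \<open>4 * real m / r\<close> is independent of \<open>k\<close>
    and so survives the limit.\<close>
  then have "cmod (\<Phi> f) \<le> (4 * real m / r) * nrm f" if "f \<in> B" for f
    using that by (intro LIMSEQ_le_const2[OF tendsto_norm[OF lim]]) auto
  then show ?thesis by blast
qed

end

subsection \<open>Polynomials\<close>

abbreviation disk_poly :: "complex poly \<Rightarrow> cfun" where
  "disk_poly p \<equiv> on_disk (poly p)"

text \<open>In \<open>disk_poly_mult\<close> one factor is left uncut because it acts as the symbol
  of a multiplication operator, which need not vanish off the disk.\<close>

lemma disk_poly_0: "disk_poly 0 = 0"
  and disk_poly_add: "disk_poly (p + q) = disk_poly p + disk_poly q"
  and disk_poly_diff: "disk_poly (p - q) = disk_poly p - disk_poly q"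
  and disk_poly_smult: "disk_poly (smult c p) = cscale c (disk_poly p)"
  and disk_poly_mult: "disk_poly (p * q) = poly p * disk_poly q"
  by (auto simp: on_disk_def cscale_def fun_eq_iff)

text \<open>
  Enlarging a subspace by one vector cannot create polynomials of unbounded degree: two
  polynomials of different degrees in the larger space have a nontrivial combination, of the larger
  degree, in the smaller one.
\<close>

lemma unbounded_degree_finite_codim:
  assumes "finite F" "cfun.subspace W"
    and "\<And>m. \<exists>p. disk_poly p \<in> cfun.span (W \<union> F) \<and> degree p > m"
  shows "\<exists>p. disk_poly p \<in> W \<and> degree p > m"
  using assms
proof (induction F arbitrary: W m rule: finite_induct)
  case empty
  then show ?case by (metis cfun.span_eq_iff sup_bot_right)
next
  case (insert x F)
  \<comment> \<open>The vector \<open>x\<close> is moved into the subspace, so that the induction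
    hypothesis for \<open>F\<close> applies to the span of \<open>W\<close> and
    \<open>x\<close>.\<close>
  have "cfun.span (W \<union> insert x F) \<subseteq> cfun.span (cfun.span (insert x W) \<union> F)"
    by (intro cfun.span_minimal cfun.subspace_span)
      (auto intro: cfun.span_base)
  then have "\<exists>p. disk_poly p \<in> cfun.span (cfun.span (insert x W) \<union> F) \<and> degree p > m" for m
    using insert.prems(2) by blast
  then have big: "\<exists>p. disk_poly p \<in> cfun.span (insert x W) \<and> degree p > m" for m
    using insert.IH[OF cfun.subspace_span] by blast
  have W: "cfun.span W = W" using insert.prems(1) cfun.span_eq_iff by blast
  obtain p where p: "disk_poly p \<in> cfun.span (insert x W)" "degree p > m" using big by blast
  obtain q where q: "disk_poly q \<in> cfun.span (insert x W)" "degree q > degree p" using big by blast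
  obtain a where a: "disk_poly p - cscale a x \<in> W"
    using p(1) unfolding cfun.span_insert W by blast
  obtain b where b: "disk_poly q - cscale b x \<in> W"
    using q(1) unfolding cfun.span_insert W by blast
  show ?case
  proof (cases "a = 0")
    \<comment> \<open>With \<open>a = 0\<close> the combination below would lose the leading term of
      \<open>q\<close>, but then \<open>p\<close> itself lies in \<open>W\<close>.\<close>
    case True
    then show ?thesis using a p by auto
  next
    case False
    have "cscale a (disk_poly q - cscale b x) - cscale b (disk_poly p - cscale a x) \<in> W"
      using a b insert.prems(1) cfun.subspace_diff cfun.subspace_scale by blast
    also have "cscale a (disk_poly q - cscale b x) - cscale b (disk_poly p - cscale a x)
        = disk_poly (smult a q - smult b p)"
      by (auto simp: disk_poly_diff disk_poly_smult cscale_def fun_eq_iff algebra_simps)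
    finally have "disk_poly (smult a q - smult b p) \<in> W" .
    moreover have "degree (smult a q - smult b p) = degree q"
      unfolding diff_conv_add_uminus using False q(2)
      by (subst degree_add_eq_left) (auto intro: le_less_trans[OF degree_smult_le])
    ultimately show ?thesis using p(2) q(2) by (metis less_trans)
  qed
qed

text \<open>The difference quotient has a removable singularity at \<open>a\<close>, filled by the
  derivative.\<close>

lemma holomorphic_divide_root:
  assumes "f holomorphic_on S" "open S" "a \<in> S"
  obtains g where "g holomorphic_on S" "\<And>z. z \<in> S \<Longrightarrow> f z = f a + (z - a) * g z"
proof
  show "(\<lambda>z. if z = a then deriv f a else (f z - f a) / (z - a)) holomorphic_on S"
    using assms pole_lemma_open by blast
  show "f z = f a + (z - a) * (if z = a then deriv f a else (f z - f a) / (z - a))" for z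
    by simp
qed

text \<open>A zero on the circle is approached along its radius. Conversely, a closed annulus that
  avoids the finitely many interior zeros is compact, so \<open>p\<close> has a positive minimum
  modulus on it.\<close>

lemma bounded_away_near_boundary_poly_iff:
  "bounded_away_near_boundary (poly p) \<longleftrightarrow> (\<forall>\<zeta>\<in>sphere 0 1. poly p \<zeta> \<noteq> 0)"
proof
  assume "bounded_away_near_boundary (poly p)"
  then obtain e r where e: "e > 0" and r: "0 < r" "r < 1"
    and away: "\<And>z. r < cmod z \<Longrightarrow> cmod z < 1 \<Longrightarrow> e < cmod (poly p z)"
    unfolding bounded_away_near_boundary_def by blast
  show "\<forall>\<zeta>\<in>sphere 0 1. poly p \<zeta> \<noteq> 0"
  proof safe
    fix \<zeta> :: complex assume \<zeta>: "\<zeta> \<in> sphere 0 1" "poly p \<zeta> = 0"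
    have "((\<lambda>t::real. cmod (poly p (of_real t * \<zeta>))) \<longlongrightarrow> cmod (poly p (of_real 1 * \<zeta>))) (at_left 1)"
      by (intro tendsto_intros)
    moreover have "eventually (\<lambda>t::real. r < t \<and> t < 1) (at_left 1)"
      using r by (intro eventually_at_leftI[of r]) auto
    then have "eventually (\<lambda>t::real. e \<le> cmod (poly p (of_real t * \<zeta>))) (at_left 1)"
    proof eventually_elim
      case (elim t)
      then have "cmod (of_real t * \<zeta>) = t" using \<zeta>(1) r by (simp add: norm_mult)
      then show ?case using away[of "of_real t * \<zeta>"] elim by simp
    qed
    ultimately have "e \<le> cmod (poly p (of_real 1 * \<zeta>))"
      by (rule tendsto_lowerbound) simp
    then show False using \<zeta> e by simp
  qed
next
  assume nz: "\<forall>\<zeta>\<in>sphere 0 1. poly p \<zeta> \<noteq> 0"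
  have "(1::complex) \<in> sphere 0 1" by simp
  then have "poly p 1 \<noteq> 0" using nz by blast
  then have "p \<noteq> 0" by auto
  \<comment> \<open>The entry \<open>1/2\<close> gives \<open>R\<close> a maximum even when
    \<open>p\<close> has no zero inside.\<close>
  define R where "R = insert (1/2) (cmod ` {z. poly p z = 0 \<and> cmod z < 1})"
  have fin: "finite R"
    unfolding R_def using finite_subset[OF _ poly_roots_finite[OF \<open>p \<noteq> 0\<close>]] by simp
  have "R \<noteq> {}" "\<forall>x\<in>R. x < 1" "1/2 \<in> R" by (auto simp: R_def)
  then have mx: "Max R < 1" "1/2 \<le> Max R" using fin by (simp, intro Max_ge)
  define r where "r = (Max R + 1) / 2"
  have r: "0 < r" "r < 1" "Max R < r" using mx by (auto simp: r_def)
  define A where "A = cball (0::complex) 1 - ball 0 r"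
  have nzA: "poly p z \<noteq> 0" if "z \<in> A" for z
  proof
    assume "poly p z = 0"
    moreover have "r \<le> cmod z" "cmod z \<le> 1" using that by (auto simp: A_def)
    ultimately have "cmod z < 1" using nz by (auto simp: order_le_less)
    then have "cmod z \<in> R" using \<open>poly p z = 0\<close> by (auto simp: R_def)
    then show False using Max_ge[OF fin] r \<open>r \<le> cmod z\<close> by fastforce
  qed
  have "compact A" unfolding A_def by (intro compact_diff) auto
  moreover have "1 \<in> A" using r by (simp add: A_def)
  then have "A \<noteq> {}" by blast
  moreover have "continuous_on A (\<lambda>z. cmod (poly p z))" by (intro continuous_intros)
  ultimately have "\<exists>w\<in>A. \<forall>z\<in>A. cmod (poly p w) \<le> cmod (poly p z)"
    by (rule continuous_attains_inf)
  then obtain w where w: "w \<in> A" "\<And>z. z \<in> A \<Longrightarrow> cmod (poly p w) \<le> cmod (poly p z)"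
    by blast
  have pos: "cmod (poly p w) > 0" using nzA w by simp
  show "bounded_away_near_boundary (poly p)"
    unfolding bounded_away_near_boundary_def
  proof (intro exI conjI allI impI)
    \<comment> \<open>Half the minimum, because the definition asks for a strict inequality.\<close>
    show "cmod (poly p w) / 2 > 0" "0 < r" "r < 1" using pos r by auto
    fix z assume "r < cmod z \<and> cmod z < 1"
    then have "cmod (poly p w) \<le> cmod (poly p z)" by (intro w(2)) (auto simp: A_def)
    then show "cmod (poly p w) / 2 < cmod (poly p z)" using pos by linarith
  qed
qed

section \<open>Polynomial multiplication and division on an admissible space\<close>

locale admissible =
  fixes B :: "cfun set" and nrm :: "cfun \<Rightarrow> real"
  assumes adm: "admissible_space B nrm"
begin

sublocale banach_cfuns B nrm
  using adm by unfold_locales (simp add: admissible_space_def)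

lemma B_hol: "f \<in> B \<Longrightarrow> f holomorphic_on unit_disk"
  and B_outside: "f \<in> B \<Longrightarrow> z \<notin> unit_disk \<Longrightarrow> f z = 0"
  and disk_poly_mem: "disk_poly p \<in> B"
  using adm by (auto simp: admissible_space_def hol_disk_def)

lemma B_ext: "f \<in> B \<Longrightarrow> g \<in> B \<Longrightarrow> (\<And>z. z \<in> unit_disk \<Longrightarrow> f z = g z) \<Longrightarrow> f = g"
  using B_outside by (metis ext)

lemma bounded_mult_z: "bounded_operator B nrm ((*) (\<lambda>z. z))"
  using adm by (simp add: admissible_space_def)

lemma mult_z_mem: "f \<in> B \<Longrightarrow> (\<lambda>z. z) * f \<in> B"
  using bounded_mult_z unfolding bounded_operator_def by (metis image_subset_iff)

text \<open>Induction along Horner's rule: \<open>pCons a p\<close> acts as scaling by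
  \<open>a\<close> plus multiplication by \<open>z\<close> after \<open>p\<close>. The bound is
  taken positive so that later estimates can divide by it.\<close>

lemma poly_mult_mem: "f \<in> B \<Longrightarrow> poly p * f \<in> B"
  and poly_mult_bounded: "\<exists>K>0. \<forall>f\<in>B. nrm (poly p * f) \<le> K * nrm f"
proof -
  have "\<exists>K>0. \<forall>f\<in>B. poly p * f \<in> B \<and> nrm (poly p * f) \<le> K * nrm f"
  proof (induction p)
    case 0
    have "poly 0 * f = 0" for f :: cfun by (auto simp: fun_eq_iff)
    then have "poly 0 * f \<in> B \<and> nrm (poly 0 * f) \<le> 1 * nrm f" if "f \<in> B" for f
      using zero_mem nrm_nonneg[OF that] by (simp only: nrm_0 mult_1 simp_thms)
    then show ?case using zero_less_one by blast
  next
    case (pCons a p)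
    then obtain K where K: "K > 0" "\<And>f. f \<in> B \<Longrightarrow> poly p * f \<in> B"
      "\<And>f. f \<in> B \<Longrightarrow> nrm (poly p * f) \<le> K * nrm f" by blast
    have "\<exists>L. \<forall>f\<in>B. nrm ((\<lambda>z. z) * f) \<le> L * nrm f"
      using bounded_mult_z unfolding bounded_operator_def by (elim conjE)
    then obtain L where L: "\<And>f. f \<in> B \<Longrightarrow> nrm ((\<lambda>z. z) * f) \<le> L * nrm f" by blast
    have eq: "poly (pCons a p) * f = cscale a f + (\<lambda>z. z) * (poly p * f)" for f
      by (auto simp: fun_eq_iff cscale_def algebra_simps)
    have "nrm (poly (pCons a p) * f) \<le> (cmod a + \<bar>L\<bar> * K + 1) * nrm f" if f: "f \<in> B" for f
    proof -
      have "nrm (poly (pCons a p) * f) \<le> nrm (cscale a f) + nrm ((\<lambda>z. z) * (poly p * f))"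
        unfolding eq using nrm_triangle[OF scale_mem[OF f] mult_z_mem[OF K(2)[OF f]]] .
      moreover have "nrm (cscale a f) = cmod a * nrm f" using nrm_scale f by blast
      moreover have "nrm ((\<lambda>z. z) * (poly p * f)) \<le> L * nrm (poly p * f)" by (rule L[OF K(2)[OF f]])
      moreover have "L * nrm (poly p * f) \<le> \<bar>L\<bar> * nrm (poly p * f)"
        using nrm_nonneg K(2)[OF f] by (intro mult_right_mono) auto
      moreover have "\<bar>L\<bar> * nrm (poly p * f) \<le> \<bar>L\<bar> * (K * nrm f)"
        using K(3)[OF f] by (intro mult_left_mono) auto
      ultimately show ?thesis using nrm_nonneg[OF f] by (simp add: algebra_simps)
    qed
    moreover have "poly (pCons a p) * f \<in> B" if "f \<in> B" for f
      unfolding eq by (intro add_mem scale_mem mult_z_mem K(2) that)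
    moreover have "cmod a + \<bar>L\<bar> * K + 1 > 0" using K(1) by (simp add: add_nonneg_pos)
    ultimately show ?case by blast
  qed
  then show "f \<in> B \<Longrightarrow> poly p * f \<in> B" "\<exists>K>0. \<forall>f\<in>B. nrm (poly p * f) \<le> K * nrm f" by blast+
qed

lemma multiplier_poly: "multiplier B (poly p)"
  unfolding multiplier_def using poly_mult_mem by (auto intro: holomorphic_intros)

lemma bounded_operator_poly: "bounded_operator B nrm ((*) (poly p))"
  unfolding bounded_operator_def using poly_mult_mem poly_mult_bounded[of p]
  by (auto simp: fun_eq_iff cscale_def algebra_simps)

lemma subspace_poly_range: "cfun.subspace ((*) (poly p) ` B)"
proof (rule cfun.subspaceI)
  show "0 \<in> (*) (poly p) ` B"
    using zero_mem by (intro image_eqI[of _ _ 0]) (auto simp: fun_eq_iff)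
  show "f + g \<in> (*) (poly p) ` B" if fg: "f \<in> (*) (poly p) ` B" "g \<in> (*) (poly p) ` B" for f g
  proof -
    obtain f' g' where "f' \<in> B" "g' \<in> B" "f = poly p * f'" "g = poly p * g'"
      using fg by (auto simp: image_iff)
    then show ?thesis
      using add_mem by (intro image_eqI[of _ _ "f' + g'"]) (auto simp: fun_eq_iff algebra_simps)
  qed
  show "cscale c f \<in> (*) (poly p) ` B" if f: "f \<in> (*) (poly p) ` B" for f c
  proof -
    obtain f' where "f' \<in> B" "f = poly p * f'" using f by blast
    then show ?thesis
      using scale_mem by (intro image_eqI[of _ _ "cscale c f'"]) (auto simp: fun_eq_iff cscale_def)
  qed
qed

text \<open>\<open>f\<close> vanishes off the finitely many zeros of \<open>p\<close>, hence on the
  whole disk by the identity theorem.\<close>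

lemma poly_kernel:
  assumes "p \<noteq> 0" "f \<in> B" "poly p * f = 0"
  shows "f = 0"
proof (rule B_ext[OF assms(2) zero_mem])
  fix z :: complex assume z: "z \<in> unit_disk"
  have fin: "finite {x. poly p x = 0}" by (rule poly_roots_finite[OF assms(1)])
  have "infinite unit_disk" using z finite_imp_not_open open_ball by blast
  then have "unit_disk - {x. poly p x = 0} \<noteq> {}" using fin by (metis finite_Diff2 finite.emptyI)
  moreover have "f w = 0" if "w \<in> unit_disk - {x. poly p x = 0}" for w
    using that fun_cong[OF assms(3), of w] by simp
  ultimately show "f z = 0 z"
    using analytic_continuation_open[of "unit_disk - {x. poly p x = 0}" unit_disk f "\<lambda>_. 0" z]
      fin z B_hol[OF assms(2)] by (auto intro: open_Diff finite_imp_closed)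
qed

text \<open>Condition (ii) speaks of continuity; rescaling from a ball around \<open>0\<close> turns
  it into the norm bound that uniform boundedness takes as input.\<close>

lemma evaluation_bounded:
  assumes z: "z \<in> unit_disk"
  shows "\<exists>K. \<forall>f\<in>B. cmod (f z) \<le> K * nrm f"
proof -
  have cont: "continuous_map mtopology euclidean (\<lambda>f. f z)"
    using adm z by (auto simp: admissible_space_def norm_top_def)
  have "openin mtopology {f \<in> topspace mtopology. f z \<in> ball 0 1}"
    by (rule openin_continuous_map_preimage[OF cont]) auto
  moreover have "0 \<in> {f \<in> topspace mtopology. f z \<in> ball 0 1}" using zero_mem by simp
  ultimately obtain r where r: "r > 0" "mball 0 r \<subseteq> {f \<in> topspace mtopology. f z \<in> ball 0 1}"
    unfolding openin_mtopology by blast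
  have small: "cmod (f z) \<le> 1" if "f \<in> B" "nrm f < r" for f
  proof -
    have "nrm (0 - f) = nrm f" using nrm_minus_commute[OF zero_mem that(1)] by simp
    then have "f \<in> mball 0 r" using that zero_mem by (simp add: norm_dist_def)
    then show ?thesis using r(2) by auto
  qed
  have "cmod (f z) \<le> (2 / r) * nrm f" if f: "f \<in> B" for f
  proof (cases "f = 0")
    case False
    then have pos: "nrm f > 0" using nrm_nonneg nrm_eq_0_iff f by (metis order_le_less)
    define t where "t = r / (2 * nrm f)"
    have t: "t > 0" "t * nrm f < r" using pos r by (auto simp: t_def)
    have "cmod (cscale (of_real t) f z) \<le> 1"
      using small[of "cscale (of_real t) f"] f scale_mem nrm_scale t by simp
    then have "t * cmod (f z) \<le> 1" using t by (simp add: cscale_def norm_mult)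
    then show ?thesis using pos r by (simp add: t_def field_simps)
  qed (simp add: nrm_0)
  then show ?thesis by blast
qed

text \<open>One zero is split off at a time. The quotient by \<open>z - a\<close> is holomorphic
  because \<open>a\<close> lies in the disk, and it belongs to \<open>B\<close> by condition
  (iv).\<close>

lemma divide_poly:
  assumes "p \<noteq> 0" "\<And>z. poly p z = 0 \<Longrightarrow> z \<in> unit_disk" "f \<in> B"
  shows "\<exists>g\<in>B. \<exists>r. f = poly p * g + disk_poly r \<and> (r = 0 \<or> degree r < degree p)"
  using assms
proof (induction "degree p" arbitrary: p)
  case 0
  then obtain c where c: "p = [:c:]" using degree_eq_zeroE by metis
  then have "f = poly p * cscale (1 / c) f + disk_poly 0"
    using 0 by (auto simp: fun_eq_iff cscale_def disk_poly_0)
  then show ?case using scale_mem 0 by blast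
next
  case (Suc d)
  have "coeff p (Suc d) \<noteq> 0" using Suc.hyps(2) Suc.prems(1) by (metis leading_coeff_0_iff)
  then have "coeff p 0 = 0 \<or> (\<exists>i\<in>{1..degree p}. coeff p i \<noteq> 0)"
    using Suc.hyps(2) by (metis One_nat_def Suc_le_mono atLeastAtMost_iff le0 order_refl)
  then obtain a where "(\<Sum>i\<le>degree p. coeff p i * a ^ i) = 0"
    by (rule fundamental_theorem_of_algebra)
  then have a: "poly p a = 0" by (simp add: poly_altdef)
  then obtain p1 where p1: "p = [:- a, 1:] * p1" using poly_eq_0_iff_dvd dvdE by metis
  have nz: "p1 \<noteq> 0" using p1 Suc.prems by auto
  have deg: "degree p = Suc (degree p1)" using p1 nz by (auto simp: degree_mult_eq simp del: mult_pCons_left)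
  have "\<And>z. poly p1 z = 0 \<Longrightarrow> z \<in> unit_disk" using Suc.prems(2) p1 by simp
  then obtain g r where g: "g \<in> B" and f: "f = poly p1 * g + disk_poly r"
    and r: "r = 0 \<or> degree r < degree p1"
    using Suc.hyps deg nz Suc.prems(3) by (metis nat.inject)
  have aD: "a \<in> unit_disk" using Suc.prems(2) a by blast
  obtain h where h: "h holomorphic_on unit_disk"
    "\<And>z. z \<in> unit_disk \<Longrightarrow> g z = g a + (z - a) * h z"
    using holomorphic_divide_root[OF B_hol[OF g] open_ball aD] by blast
  have hol: "on_disk h \<in> hol_disk"
    unfolding hol_disk_def using holomorphic_transform[OF h(1)] by (simp add: on_disk_def)
  have geq: "g = poly [:- a, 1:] * on_disk h + disk_poly [:g a:]"
    using h(2) B_outside[OF g] by (auto simp: fun_eq_iff on_disk_def algebra_simps)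
  then have "poly [:- a, 1:] * on_disk h = g - disk_poly [:g a:]"
    by (metis add_diff_cancel_right')
  then have "poly [:- a, 1:] * on_disk h \<in> B" using diff_mem[OF g disk_poly_mem] by simp
  moreover have "poly [:- a, 1:] z = 0 \<longrightarrow> z \<in> unit_disk" for z using aD by auto
  ultimately have hB: "on_disk h \<in> B"
    using adm hol unfolding admissible_space_def by blast
  have "f = poly p1 * (poly [:- a, 1:] * on_disk h + disk_poly [:g a:]) + disk_poly r"
    using f geq by simp
  \<comment> \<open>The constant remainder \<open>g a\<close> of the new division comes back
    multiplied by \<open>p1\<close>, whose degree is one below that of \<open>p\<close>.\<close>
  also have "\<dots> = poly p * on_disk h + disk_poly (smult (g a) p1 + r)"
    unfolding p1 by (auto simp: fun_eq_iff on_disk_def algebra_simps)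
  finally have "f = poly p * on_disk h + disk_poly (smult (g a) p1 + r)" .
  moreover have "degree (smult (g a) p1 + r) < degree p"
    unfolding deg less_Suc_eq_le using r degree_smult_le[of "g a" p1]
    by (intro degree_add_le) auto
  ultimately show ?case using hB by blast
qed

text \<open>Each step adds the line spanned by the next monomial. The degree bound is phrased
  through vanishing coefficients so that \<open>k = 0\<close> leaves only the zero polynomial.
  Closedness and the subspace property go together because adding a line uses both.\<close>

lemma closed_add_polys:
  assumes "closedin (norm_top B nrm) N" "cfun.subspace N"
  shows "closedin (norm_top B nrm) {n + disk_poly q | n q. n \<in> N \<and> (\<forall>i\<ge>k. coeff q i = 0)}
    \<and> cfun.subspace {n + disk_poly q | n q. n \<in> N \<and> (\<forall>i\<ge>k. coeff q i = 0)}"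
    (is "closedin _ (?W k) \<and> cfun.subspace (?W k)")
proof (induction k)
  case 0
  have "?W 0 = N"
  proof -
    have "(\<forall>i\<ge>0. coeff q i = 0) \<longleftrightarrow> q = 0" for q :: "complex poly" by (auto simp: poly_eq_iff)
    then show ?thesis by (auto simp: disk_poly_0)
  qed
  then show ?case using assms by simp
next
  case (Suc k)
  have eq: "?W (Suc k) = {w + cscale c (disk_poly (monom 1 k)) | w c. w \<in> ?W k}"
  proof (rule subset_antisym; rule subsetI)
    fix f assume "f \<in> ?W (Suc k)"
    then obtain n q where n: "n \<in> N" "\<forall>i\<ge>Suc k. coeff q i = 0" "f = n + disk_poly q" by blast
    have "coeff (q - monom (coeff q k) k) i = 0" if "i \<ge> k" for i
      using n(2) that by (cases "i = k") (simp_all add: Suc_le_eq)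
    then have "\<forall>i\<ge>k. coeff (q - monom (coeff q k) k) i = 0" by blast
    then have "n + disk_poly (q - monom (coeff q k) k) \<in> ?W k" using n by blast
    moreover have "f = n + disk_poly (q - monom (coeff q k) k)
        + cscale (coeff q k) (disk_poly (monom 1 k))"
      using n(3) by (auto simp: fun_eq_iff on_disk_def cscale_def poly_monom)
    ultimately show "f \<in> {w + cscale c (disk_poly (monom 1 k)) | w c. w \<in> ?W k}" by blast
  next
    fix f assume "f \<in> {w + cscale c (disk_poly (monom 1 k)) | w c. w \<in> ?W k}"
    then obtain w c where w: "w \<in> ?W k" "f = w + cscale c (disk_poly (monom 1 k))" by blast
    from w(1) obtain n q where "n \<in> N" "\<forall>i\<ge>k. coeff q i = 0" "w = n + disk_poly q" by blast
    then have n: "n \<in> N" "\<forall>i\<ge>k. coeff q i = 0"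
      "f = n + disk_poly q + cscale c (disk_poly (monom 1 k))" using w(2) by simp_all
    have "f = n + disk_poly (q + monom c k)"
      unfolding n(3) by (auto simp: fun_eq_iff on_disk_def cscale_def poly_monom)
    moreover have "\<forall>i\<ge>Suc k. coeff (q + monom c k) i = 0" using n(2) by auto
    ultimately show "f \<in> ?W (Suc k)" using n(1) by blast
  qed
  have closed: "closedin (norm_top B nrm) (?W (Suc k))"
    unfolding eq by (rule closed_add_line[OF conjunct1[OF Suc] conjunct2[OF Suc] disk_poly_mem])
  have sub: "cfun.subspace (?W (Suc k))"
  proof (rule cfun.subspaceI)
    show "0 \<in> ?W (Suc k)"
    proof (intro CollectI exI conjI)
      show "0 = 0 + disk_poly 0" by (simp only: disk_poly_0 add_0_right)
    qed (rule cfun.subspace_0[OF assms(2)], simp)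
    fix f assume "f \<in> ?W (Suc k)"
    then obtain n q where n: "n \<in> N" "\<forall>i\<ge>Suc k. coeff q i = 0" "f = n + disk_poly q" by blast
    show "cscale c f \<in> ?W (Suc k)" for c
    proof (intro CollectI exI conjI)
      show "cscale c f = cscale c n + disk_poly (smult c q)"
        unfolding n(3) by (simp add: disk_poly_smult cfun.scale_right_distrib)
    qed (rule cfun.subspace_scale[OF assms(2) n(1)], use n(2) in simp)
    fix g assume "g \<in> ?W (Suc k)"
    then obtain n' q' where n': "n' \<in> N" "\<forall>i\<ge>Suc k. coeff q' i = 0" "g = n' + disk_poly q'"
      by blast
    show "f + g \<in> ?W (Suc k)"
    proof (intro CollectI exI conjI)
      show "f + g = (n + n') + disk_poly (q + q')"
        unfolding n(3) n'(3) by (simp add: disk_poly_add)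
    qed (rule cfun.subspace_add[OF assms(2) n(1) n'(1)], use n(2) n'(2) in simp)
  qed
  show ?case using closed sub by blast
qed

subsection \<open>Invariant subspaces\<close>

text \<open>Continuity of multiplication by a polynomial. It is applied to the dense set of
  polynomials and to a range that has \<open>1\<close> in its closure.\<close>

lemma poly_mult_closure:
  assumes "closedin (norm_top B nrm) N" "\<And>g. g \<in> S \<Longrightarrow> poly p * g \<in> N"
    and f: "f \<in> norm_top B nrm closure_of S"
  shows "poly p * f \<in> N"
proof -
  have fB: "f \<in> B" using f by (simp add: in_closure_iff)
  obtain K where K: "K > 0" "\<And>h. h \<in> B \<Longrightarrow> nrm (poly p * h) \<le> K * nrm h"
    using poly_mult_bounded[of p] by blast
  show ?thesis
  proof (rule closed_limit[OF assms(1) poly_mult_mem[OF fB]])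
    fix e :: real assume "e > 0"
    then have "e / K > 0" using K(1) by simp
    then obtain g where g: "g \<in> S" "g \<in> B" "nrm (f - g) < e / K"
      using f in_closure_iff by blast
    have eq: "poly p * f - poly p * g = poly p * (f - g)"
      by (auto simp: fun_eq_iff algebra_simps)
    have "nrm (poly p * f - poly p * g) \<le> K * nrm (f - g)"
      unfolding eq by (rule K(2)[OF diff_mem[OF fB g(2)]])
    also have "K * nrm (f - g) < e" using g(3) K(1) by (simp add: field_simps)
    finally show "\<exists>g\<in>N. nrm (poly p * f - g) < e" using assms(2)[OF g(1)] by blast
  qed
qed

text \<open>The second conclusion lets polynomials represent all classes modulo \<open>N\<close>; it
  later splits \<open>B\<close> at a boundary zero.\<close>

lemma invariant_subspace_generator:
  assumes fc: "finite_codimensional B N" and closed: "closedin (norm_top B nrm) N"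
    and inv: "(*) (\<lambda>z. z) ` N \<subseteq> N"
  shows "\<exists>p. p \<noteq> 0 \<and> (\<forall>q. disk_poly q \<in> N \<longrightarrow> q \<noteq> 0 \<longrightarrow> degree p \<le> degree q) \<and>
      (*) (poly p) ` B \<subseteq> N \<and> N = norm_top B nrm closure_of ((*) (poly p) ` B)"
    and "f \<in> B \<Longrightarrow> \<exists>n\<in>N. \<exists>q. f = n + disk_poly q"
proof -
  have sub: "cfun.subspace N" and NB: "N \<subseteq> B"
    using fc by (auto simp: finite_codimensional_def)
  obtain F where F: "finite F" "cfun.span (N \<union> F) = B"
    using fc by (auto simp: finite_codimensional_def)
  have "\<exists>p. disk_poly p \<in> cfun.span (N \<union> F) \<and> degree p > m" for m
    unfolding F(2) using disk_poly_mem
    by (intro exI[of _ "monom 1 (Suc m)"]) (simp add: degree_monom_eq)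
  \<comment> \<open>Positive degree is asked for here in order to get a nonzero polynomial in
    \<open>N\<close>.\<close>
  then obtain q0 where "disk_poly q0 \<in> N" "degree q0 > 0"
    using unbounded_degree_finite_codim[OF F(1) sub, of 0] by blast
  then have "q0 \<noteq> 0 \<and> disk_poly q0 \<in> N" by auto
  from ex_has_least_nat[of "\<lambda>q. q \<noteq> 0 \<and> disk_poly q \<in> N", OF this, of degree]
  obtain p where p: "p \<noteq> 0" "disk_poly p \<in> N"
    and least: "\<And>q. disk_poly q \<in> N \<Longrightarrow> q \<noteq> 0 \<Longrightarrow> degree p \<le> degree q"
    by blast
  have mult_inv: "poly q * f \<in> N" if f: "f \<in> N" for q f
  proof (induction q)
    case 0
    have "poly 0 * f = 0" by (auto simp: fun_eq_iff)
    then show ?case using cfun.subspace_0[OF sub] by (simp only:)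
  next
    case (pCons a q)
    have eq: "poly (pCons a q) * f = cscale a f + (\<lambda>z. z) * (poly q * f)"
      by (auto simp: fun_eq_iff cscale_def algebra_simps)
    have "(\<lambda>z. z) * (poly q * f) \<in> N" using inv pCons.IH by (rule subsetD[OF _ imageI])
    then show ?case
      unfolding eq by (intro cfun.subspace_add[OF sub] cfun.subspace_scale[OF sub] f)
  qed
  have poly_in: "poly p * disk_poly q \<in> N" for q
    using mult_inv[OF p(2), of q] by (metis disk_poly_mult mult.commute)
  have "norm_top B nrm closure_of range disk_poly = B"
    using adm by (simp add: admissible_space_def)
  then have range: "(*) (poly p) ` B \<subseteq> N"
    using poly_mult_closure[OF closed, of "range disk_poly" p] poly_in by blast
  define N0 where "N0 = norm_top B nrm closure_of ((*) (poly p) ` B)"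
  have range_B: "(*) (poly p) ` B \<subseteq> B" using poly_mult_mem by blast
  have sub0: "cfun.subspace N0"
    unfolding N0_def by (rule subspace_closure[OF subspace_poly_range range_B])
  have closed0: "closedin (norm_top B nrm) N0" by (simp add: N0_def)
  have range0: "(*) (poly p) ` B \<subseteq> N0"
    unfolding N0_def using range_B by (intro closure_of_subset) (simp add: topspace_norm_top)
  have N0N: "N0 \<subseteq> N" unfolding N0_def by (rule closure_of_minimal[OF range closed])
  define W where "W = {n + disk_poly q | n q. n \<in> N0 \<and> (\<forall>i\<ge>degree p. coeff q i = 0)}"
  have closedW: "closedin (norm_top B nrm) W"
    unfolding W_def using closed_add_polys[OF closed0 sub0] by (rule conjunct1)
  have "disk_poly q \<in> W" for q
  proof -
    have "disk_poly q = disk_poly (p * (q div p) + q mod p)" by simp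
    also have "\<dots> = poly p * disk_poly (q div p) + disk_poly (q mod p)"
      by (simp only: disk_poly_add disk_poly_mult)
    finally have "disk_poly q = poly p * disk_poly (q div p) + disk_poly (q mod p)" .
    moreover have "poly p * disk_poly (q div p) \<in> N0" using range0 disk_poly_mem by blast
    moreover have "\<forall>i\<ge>degree p. coeff (q mod p) i = 0"
      using degree_mod_less[OF p(1), of q] by (auto intro: coeff_eq_0)
    ultimately show ?thesis unfolding W_def by blast
  qed
  then have "norm_top B nrm closure_of range disk_poly \<subseteq> W"
    by (intro closure_of_minimal closedW) blast
  then have BW: "B \<subseteq> W" using adm by (simp add: admissible_space_def)
  have "N \<subseteq> N0"
  proof
    fix f assume f: "f \<in> N"
    then obtain n q where n: "n \<in> N0" "\<forall>i\<ge>degree p. coeff q i = 0" "f = n + disk_poly q"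
      using NB BW unfolding W_def by blast
    have "disk_poly q = f - n" using n(3) by simp
    then have "disk_poly q \<in> N" using cfun.subspace_diff[OF sub f] n(1) N0N by auto
    \<comment> \<open>For nonzero \<open>q\<close>, minimality would give
      \<open>degree p \<le> degree q\<close>, so the leading coefficient of \<open>q\<close> would
      vanish.\<close>
    then have "q = 0" using least n(2) leading_coeff_0_iff by blast
    then show "f \<in> N0" using n by (simp only: disk_poly_0 add_0_right)
  qed
  then have "N = norm_top B nrm closure_of ((*) (poly p) ` B)" using N0N N0_def by blast
  then show "\<exists>p. p \<noteq> 0 \<and> (\<forall>q. disk_poly q \<in> N \<longrightarrow> q \<noteq> 0 \<longrightarrow> degree p \<le> degree q) \<and>
      (*) (poly p) ` B \<subseteq> N \<and> N = norm_top B nrm closure_of ((*) (poly p) ` B)"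
    using p(1) least range by blast
  show "\<exists>n\<in>N. \<exists>q. f = n + disk_poly q" if "f \<in> B"
    using that BW N0N unfolding W_def by blast
qed

section \<open>Zeros of the generator outside the disk or on its boundary\<close>

text \<open>Cancelling a linear factor lowers the degree below the minimum. The next two lemmas have
  this as the hypothesis that a bad zero contradicts.\<close>

lemma generator_quotient_notin:
  assumes "p \<noteq> 0" "\<And>q. disk_poly q \<in> N \<Longrightarrow> q \<noteq> 0 \<Longrightarrow> degree p \<le> degree q"
    and "p = [:- a, 1:] * p1"
  shows "disk_poly p1 \<notin> N"
proof
  assume mem: "disk_poly p1 \<in> N"
  have "p1 \<noteq> 0" using assms(1,3) by auto
  moreover from this have "degree p = Suc (degree p1)"
    unfolding assms(3) by (subst degree_mult_eq) auto
  ultimately show False using assms(2)[OF mem] by simp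
qed

text \<open>For \<open>cmod a > 1\<close> the point \<open>a\<close> lies outside the spectrum, so
  \<open>z - a\<close> is invertible on \<open>B\<close> and the range of multiplication by
  \<open>p\<close> would contain \<open>p1\<close>.\<close>

lemma no_root_outside:
  assumes "(*) (poly ([:- a, 1:] * p1)) ` B \<subseteq> N" "disk_poly p1 \<notin> N"
  shows "cmod a \<le> 1"
proof (rule ccontr)
  assume "\<not> cmod a \<le> 1"
  then have "\<not> ereal (cmod a) \<le> op_spectral_radius B nrm ((*) (\<lambda>z. z))"
    using adm by (simp add: admissible_space_def)
  then have "a \<notin> op_spectrum B nrm ((*) (\<lambda>z. z))"
    unfolding op_spectral_radius_def using SUP_upper by metis
  then obtain S where S: "bounded_operator B nrm S"
    "\<And>f. f \<in> B \<Longrightarrow> (\<lambda>z. z) * S f - cscale a (S f) = f"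
    unfolding op_spectrum_def by blast
  \<comment> \<open>On the disk \<open>g\<close> is the function \<open>1 / (z - a)\<close>.\<close>
  define g where "g = S (disk_poly 1)"
  have "g \<in> B" using S(1) disk_poly_mem unfolding g_def bounded_operator_def by blast
  have g: "(z - a) * g z = disk_poly 1 z" for z
    using fun_cong[OF S(2)[OF disk_poly_mem[of 1]], of z]
    by (simp add: g_def cscale_def algebra_simps)
  have "poly ([:- a, 1:] * p1) z * g z = disk_poly p1 z" for z
  proof -
    have "poly ([:- a, 1:] * p1) z * g z = poly p1 z * ((z - a) * g z)"
      by (simp add: algebra_simps)
    also have "\<dots> = disk_poly p1 z" unfolding g by (simp add: on_disk_def)
    finally show ?thesis .
  qed
  then have "poly ([:- a, 1:] * p1) * g = disk_poly p1" by (intro ext) (simp only: times_fun_apply)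
  then show False using assms \<open>g \<in> B\<close> by (metis imageI subsetD)
qed

text \<open>Type 0 makes \<open>1\<close> a limit of multiples of \<open>z - \<zeta>\<close>.
  Multiplying by \<open>p1\<close> makes \<open>p1\<close> a limit of multiples of the full product,
  hence a member of \<open>N\<close>.\<close>

lemma no_root_sphere:
  assumes "boundary_extension_type B nrm 0" "closedin (norm_top B nrm) N"
    and "(*) (poly ([:- \<zeta>, 1:] * p1)) ` B \<subseteq> N" "disk_poly p1 \<notin> N"
  shows "\<zeta> \<notin> sphere 0 1"
proof
  assume "\<zeta> \<in> sphere 0 1"
  moreover have "on_disk (\<lambda>z. (z - \<zeta>) ^ 0) = disk_poly 1" by (simp add: on_disk_def fun_eq_iff)
  moreover have "(\<lambda>z. (z - \<zeta>) ^ (0 + 1)) = poly [:- \<zeta>, 1:]" by (auto simp: fun_eq_iff)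
  ultimately have "disk_poly 1 \<in> norm_top B nrm closure_of ((*) (poly [:- \<zeta>, 1:]) ` B)"
    using assms(1) unfolding boundary_extension_type_def by metis
  moreover have "poly p1 * g \<in> N" if g: "g \<in> (*) (poly [:- \<zeta>, 1:]) ` B" for g
  proof -
    obtain h where h: "h \<in> B" "g = poly [:- \<zeta>, 1:] * h" using g by (rule imageE)
    have "poly p1 * g = poly ([:- \<zeta>, 1:] * p1) * h"
      unfolding h(2) by (auto simp: fun_eq_iff algebra_simps)
    then show ?thesis using assms(3) h(1) by auto
  qed
  ultimately have "poly p1 * disk_poly 1 \<in> N" using poly_mult_closure[OF assms(2)] by blast
  then show False using assms(4) by (metis disk_poly_mult mult.right_neutral)
qed

section \<open>Fredholm ranges and boundary zeros in positive type\<close>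

lemma fredholm_poly:
  assumes "p \<noteq> 0" "finite_codimensional B ((*) (poly p) ` B)"
    and "closedin (norm_top B nrm) ((*) (poly p) ` B)"
  shows "fredholm B nrm ((*) (poly p))"
proof -
  have "poly p * 0 = 0" by (auto simp: fun_eq_iff)
  then have "{f \<in> B. poly p * f = 0} = {0}" using poly_kernel[OF assms(1)] zero_mem by blast
  moreover have "finite_dimensional {0}"
    unfolding finite_dimensional_def by (rule exI[of _ "{}"]) simp
  ultimately show ?thesis
    unfolding fredholm_def using bounded_operator_poly assms by simp
qed

text \<open>
  Under this decomposition every member of \<open>B\<close> has Taylor coefficients of all orders at \<open>\<zeta>\<close>. They are
  continuous functionals by uniform boundedness, and the one of order \<open>n\<close> separates \<open>(z - \<zeta>)^n\<close> from
  the multiples of \<open>(z - \<zeta>)^(n+1)\<close>.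
\<close>

lemma no_boundary_decomposition:
  assumes type: "boundary_extension_type B nrm n" "n > 0" and \<zeta>: "\<zeta> \<in> sphere 0 1"
    and decomp: "\<And>f. f \<in> B \<Longrightarrow> \<exists>g\<in>B. \<exists>c. f = poly [:- \<zeta>, 1:] * g + disk_poly [:c:]"
  shows False
proof -
  \<comment> \<open>Points on the radius to \<open>\<zeta>\<close>, starting at the centre.\<close>
  define w where "w k = of_real (1 - inverse (real (Suc k))) * \<zeta>" for k :: nat
  have w_disk: "w k \<in> unit_disk" for k
  proof -
    have "0 < inverse (real (Suc k))" "inverse (real (Suc k)) \<le> 1"
      by (simp, simp add: inverse_eq_divide)
    then have "\<bar>1 - inverse (real (Suc k))\<bar> < 1" by linarith
    then show ?thesis using \<zeta> by (simp add: w_def norm_mult del: of_real_diff)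
  qed
  have "w \<longlonglongrightarrow> of_real (1 - 0) * \<zeta>"
    unfolding w_def by (intro tendsto_intros LIMSEQ_inverse_real_of_nat)
  then have w_lim: "w \<longlonglongrightarrow> \<zeta>" by simp
  have not_\<zeta>: "z - \<zeta> \<noteq> 0" if "z \<in> unit_disk" for z using that \<zeta> by fastforce
  \<comment> \<open>The boundary value at \<open>\<zeta>\<close>, taken as a limit of evaluations
    along a fixed sequence so that uniform boundedness applies.\<close>
  define L where "L f = lim (\<lambda>k. f (w k))" for f :: cfun
  have L_lim: "(\<lambda>k. f (w k)) \<longlonglongrightarrow> L f" if f: "f \<in> B" for f
  proof -
    have "extends_to_Ck (n - 1) f"
      using type f by (simp add: boundary_extension_type_def)
    then obtain g where g: "g \<in> Ck_closed_disk (n - 1)" "\<And>z. z \<in> unit_disk \<Longrightarrow> g z = f z"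
      unfolding extends_to_Ck_def by blast
    have "continuous_on (cball 0 1) g" using g(1) unfolding Ck_closed_disk_def by blast
    moreover have "\<zeta> \<in> cball 0 1" "\<And>k. w k \<in> cball 0 1"
      using \<zeta> w_disk by (auto simp: less_imp_le)
    ultimately have "(\<lambda>k. g (w k)) \<longlonglongrightarrow> g \<zeta>"
      by (intro continuous_on_tendsto_compose[OF _ w_lim]) auto
    then have "convergent (\<lambda>k. f (w k))" using g(2) w_disk convergentI by simp
    then show ?thesis unfolding L_def by (simp add: convergent_LIMSEQ_iff)
  qed
  have L_mult: "L (poly [:- \<zeta>, 1:] * g + disk_poly [:c:]) = c" if g: "g \<in> B" for g c
  proof -
    have "(\<lambda>k. (w k - \<zeta>) * g (w k) + c) \<longlonglongrightarrow> (\<zeta> - \<zeta>) * L g + c"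
      by (intro tendsto_intros w_lim L_lim g)
    moreover have "(poly [:- \<zeta>, 1:] * g + disk_poly [:c:]) (w k) = (w k - \<zeta>) * g (w k) + c" for k
      using w_disk[of k] by (simp add: on_disk_def algebra_simps)
    ultimately show ?thesis unfolding L_def by (simp only: limI) simp
  qed
  have L_diff: "L (f - g) = L f - L g" if "f \<in> B" "g \<in> B" for f g
    using LIMSEQ_unique[OF L_lim[OF diff_mem[OF that]]] tendsto_diff[OF L_lim[OF that(1)] L_lim[OF that(2)]]
    by simp
  have L_scale: "L (cscale c f) = c * L f" if "f \<in> B" for c f
    using LIMSEQ_unique[OF L_lim[OF scale_mem[OF that]]] tendsto_mult_left[OF L_lim[OF that]]
    by (simp add: cscale_def)
  \<comment> \<open>The backward shift at \<open>\<zeta>\<close>; \<open>L ((S ^^ j) f)\<close> is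
    the Taylor coefficient of order \<open>j\<close>.\<close>
  define S where "S f = on_disk (\<lambda>z. (f z - L f) / (z - \<zeta>))" for f
  have S_mult: "S (poly [:- \<zeta>, 1:] * g + disk_poly [:c:]) = g" if g: "g \<in> B" for g c
    unfolding S_def L_mult[OF g]
    using not_\<zeta> B_outside[OF g] by (auto simp: fun_eq_iff on_disk_def divide_simps algebra_simps)
  \<comment> \<open>The constant in the decomposition of \<open>f\<close> is forced to be
    \<open>L f\<close>, so \<open>S f\<close> is the other component and stays in
    \<open>B\<close>.\<close>
  have S_mem: "S f \<in> B" if "f \<in> B" for f
    using decomp[OF that] S_mult by metis
  have S_diff: "S (f - g) = S f - S g" if "f \<in> B" "g \<in> B" for f g
    unfolding S_def L_diff[OF that] by (auto simp: fun_eq_iff on_disk_def diff_divide_distrib)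
  have S_scale: "S (cscale c f) = cscale c (S f)" if "f \<in> B" for c f
    unfolding S_def L_scale[OF that] by (auto simp: fun_eq_iff on_disk_def cscale_def algebra_simps)
  have iter_mem: "(S ^^ j) f \<in> B" if "f \<in> B" for j f
    using that S_mem by (induction j) auto
  have iter_diff: "(S ^^ j) (f - g) = (S ^^ j) f - (S ^^ j) g" if "f \<in> B" "g \<in> B" for j f g
    using that S_diff iter_mem by (induction j) auto
  have iter_scale: "(S ^^ j) (cscale c f) = cscale c ((S ^^ j) f)" if "f \<in> B" for j c f
    using that S_scale iter_mem by (induction j) auto
  \<comment> \<open>The bounds alternate: bounded evaluations of \<open>(S ^^ j) f\<close> inside
    the disk give a bounded boundary value as their limit, and both together bound the evaluations
    for \<open>Suc j\<close>.\<close>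
  have L_bound: "\<exists>K. \<forall>f\<in>B. cmod (L ((S ^^ j) f)) \<le> K * nrm f"
    if eval: "\<And>z. z \<in> unit_disk \<Longrightarrow> \<exists>K. \<forall>f\<in>B. cmod ((S ^^ j) f z) \<le> K * nrm f" for j
  proof (rule bounded_functional_pointwise_limit[where \<phi> = "\<lambda>k f. (S ^^ j) f (w k)"])
    show "\<exists>K. \<forall>f\<in>B. cmod ((S ^^ j) f (w k)) \<le> K * nrm f" for k by (rule eval[OF w_disk])
  qed (simp_all add: iter_diff iter_scale L_lim iter_mem, simp add: cscale_def)
  have eval: "\<exists>K. \<forall>f\<in>B. cmod ((S ^^ j) f z) \<le> K * nrm f" if "z \<in> unit_disk" for j z
    using that
  proof (induction j arbitrary: z)
    case 0
    then show ?case using evaluation_bounded by simp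
  next
    case (Suc j)
    obtain K1 where K1: "\<And>f. f \<in> B \<Longrightarrow> cmod ((S ^^ j) f z) \<le> K1 * nrm f"
      using Suc by blast
    obtain K2 where K2: "\<And>f. f \<in> B \<Longrightarrow> cmod (L ((S ^^ j) f)) \<le> K2 * nrm f"
      using L_bound[OF Suc.IH] by blast
    have "cmod ((S ^^ Suc j) f z) \<le> ((K1 + K2) / cmod (z - \<zeta>)) * nrm f" if f: "f \<in> B" for f
    proof -
      have "(S ^^ Suc j) f z = ((S ^^ j) f z - L ((S ^^ j) f)) / (z - \<zeta>)"
        using Suc.prems by (simp add: S_def on_disk_def)
      then have "cmod ((S ^^ Suc j) f z) = cmod ((S ^^ j) f z - L ((S ^^ j) f)) / cmod (z - \<zeta>)"
        by (simp only: norm_divide)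
      also have "\<dots> \<le> (K1 * nrm f + K2 * nrm f) / cmod (z - \<zeta>)"
        using norm_triangle_ineq4[of "(S ^^ j) f z" "L ((S ^^ j) f)"] K1[OF f] K2[OF f]
        by (intro divide_right_mono norm_ge_zero) linarith
      finally show ?thesis by (simp add: algebra_simps)
    qed
    then show ?case by blast
  qed
  obtain K where K: "\<And>f. f \<in> B \<Longrightarrow> cmod (L ((S ^^ n) f)) \<le> K * nrm f"
    using L_bound[OF eval] by blast
  have iter_mult: "(S ^^ j) (poly ([:- \<zeta>, 1:] ^ j) * g) = g" if "g \<in> B" for g j
    using that
  proof (induction j arbitrary: g)
    case 0
    then show ?case by (auto simp: fun_eq_iff)
  next
    case (Suc j)
    have eq: "poly ([:- \<zeta>, 1:] ^ Suc j) * g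
        = poly [:- \<zeta>, 1:] * (poly ([:- \<zeta>, 1:] ^ j) * g) + disk_poly [:0:]"
      by (auto simp: fun_eq_iff on_disk_def algebra_simps)
    have "S (poly ([:- \<zeta>, 1:] ^ Suc j) * g) = poly ([:- \<zeta>, 1:] ^ j) * g"
      unfolding eq by (rule S_mult[OF poly_mult_mem[OF Suc.prems]])
    then show ?case using Suc by (simp only: funpow_Suc_right comp_apply)
  qed
  define f0 where "f0 = on_disk (\<lambda>z. (z - \<zeta>) ^ n)"
  have f0: "f0 = poly ([:- \<zeta>, 1:] ^ n) * disk_poly 1"
    by (auto simp: f0_def fun_eq_iff on_disk_def)
  then have f0B: "f0 \<in> B" using poly_mult_mem disk_poly_mem by simp
  have zero: "poly [:- \<zeta>, 1:] * 0 + disk_poly [:1:] = disk_poly 1"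
    by (auto simp: fun_eq_iff on_disk_def)
  have one: "L ((S ^^ n) f0) = 1"
    unfolding f0 iter_mult[OF disk_poly_mem] using L_mult[OF zero_mem, of 1] zero by simp
  \<comment> \<open>With this tolerance \<open>K\<close> times the distance stays below 1, whereas
    the functional will take the value 1 on \<open>f0 - g\<close>.\<close>
  have pos: "0 < 1 / (\<bar>K\<bar> + 1)" by (rule divide_pos_pos) linarith+
  have "f0 \<in> norm_top B nrm closure_of ((*) (\<lambda>z. (z - \<zeta>) ^ (n + 1)) ` B)"
    using type(1) \<zeta> unfolding boundary_extension_type_def f0_def by blast
  then obtain g where g: "g \<in> (*) (\<lambda>z. (z - \<zeta>) ^ (n + 1)) ` B" "g \<in> B"
      "nrm (f0 - g) < 1 / (\<bar>K\<bar> + 1)"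
    by (rule in_closureD[OF _ pos])
  obtain h where h: "h \<in> B" "g = (\<lambda>z. (z - \<zeta>) ^ (n + 1)) * h" using g(1) by (rule imageE)
  have g_eq: "g = poly ([:- \<zeta>, 1:] ^ n) * (poly [:- \<zeta>, 1:] * h)"
    unfolding h(2) by (auto simp: fun_eq_iff algebra_simps)
  have h_eq: "poly [:- \<zeta>, 1:] * h = poly [:- \<zeta>, 1:] * h + disk_poly [:0:]"
    by (auto simp: fun_eq_iff on_disk_def)
  have "L (poly [:- \<zeta>, 1:] * h) = 0"
    using L_mult[OF h(1), of 0] unfolding h_eq[symmetric] .
  then have "L ((S ^^ n) g) = 0"
    unfolding g_eq iter_mult[OF poly_mult_mem[OF h(1)]] .
  then have "L ((S ^^ n) (f0 - g)) = 1"
    using one L_diff iter_diff iter_mem f0B g(2) by simp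
  then have "1 \<le> K * nrm (f0 - g)" using K[OF diff_mem[OF f0B g(2)]] by simp
  also have "\<dots> \<le> (\<bar>K\<bar> + 1) * nrm (f0 - g)"
    using nrm_nonneg diff_mem f0B g(2) by (intro mult_right_mono) auto
  also have "\<dots> < 1" using g(3) by (simp add: pos_less_divide_eq mult.commute)
  finally show False by simp
qed

lemma range_invariant: "(*) (\<lambda>z. z) ` ((*) \<psi> ` B) \<subseteq> (*) \<psi> ` B"
proof clarify
  fix f assume "f \<in> B"
  moreover have "(\<lambda>z. z) * (\<psi> * f) = \<psi> * ((\<lambda>z. z) * f)" by (simp add: mult.left_commute)
  ultimately show "(\<lambda>z. z) * (\<psi> * f) \<in> (*) \<psi> ` B" using mult_z_mem by blast
qed

text \<open>\<open>B\<close> is the range plus the polynomials. Factoring \<open>z - \<zeta>\<close>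
  out of \<open>p\<close> and dividing each polynomial by it yields the decomposition just
  excluded.\<close>

lemma closed_range_no_boundary_root:
  assumes type: "boundary_extension_type B nrm n" "n > 0"
    and fc: "finite_codimensional B ((*) (poly p) ` B)"
    and closed: "closedin (norm_top B nrm) ((*) (poly p) ` B)"
    and \<zeta>: "\<zeta> \<in> sphere 0 1"
  shows "poly p \<zeta> \<noteq> 0"
proof
  assume "poly p \<zeta> = 0"
  then obtain p1 where p1: "p = [:- \<zeta>, 1:] * p1" using poly_eq_0_iff_dvd dvdE by metis
  have "\<exists>g\<in>B. \<exists>c. f = poly [:- \<zeta>, 1:] * g + disk_poly [:c:]" if f: "f \<in> B" for f
  proof -
    obtain n q where n: "n \<in> (*) (poly p) ` B" "f = n + disk_poly q"
      using invariant_subspace_generator(2)[OF fc closed range_invariant f] by blast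
    obtain g where g: "g \<in> B" "n = poly p * g" using n(1) by (rule imageE)
    have "poly (q - [:poly q \<zeta>:]) \<zeta> = 0" by simp
    then obtain r where "q - [:poly q \<zeta>:] = [:- \<zeta>, 1:] * r"
      using poly_eq_0_iff_dvd dvdE by metis
    then have q: "q = [:- \<zeta>, 1:] * r + [:poly q \<zeta>:]" by (simp add: algebra_simps)
    have "f = poly [:- \<zeta>, 1:] * (poly p1 * g) + disk_poly ([:- \<zeta>, 1:] * r + [:poly q \<zeta>:])"
      unfolding n(2) g(2) p1 q[symmetric] by (auto simp: fun_eq_iff algebra_simps)
    also have "\<dots> = poly [:- \<zeta>, 1:] * (poly p1 * g + disk_poly r) + disk_poly [:poly q \<zeta>:]"
      by (auto simp: fun_eq_iff on_disk_def algebra_simps)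
    finally show ?thesis
      using add_mem[OF poly_mult_mem[OF g(1)] disk_poly_mem] by blast
  qed
  then show False using no_boundary_decomposition[OF type \<zeta>] by blast
qed

text \<open>Zeros outside the closed disk are excluded by minimality, those on the circle by
  assumption, so division with remainder applies. The remainder of a member of \<open>N\<close> lies
  in \<open>N\<close> with degree below the minimum, hence is zero. Both boundary types use
  this.\<close>

lemma fredholm_range_if_no_boundary_root:
  assumes fc: "finite_codimensional B N" and closed: "closedin (norm_top B nrm) N"
    and p: "p \<noteq> 0" "\<And>q. disk_poly q \<in> N \<Longrightarrow> q \<noteq> 0 \<Longrightarrow> degree p \<le> degree q"
    and range: "(*) (poly p) ` B \<subseteq> N"
    and nz: "\<And>\<zeta>. \<zeta> \<in> sphere 0 1 \<Longrightarrow> poly p \<zeta> \<noteq> 0"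
  shows "fredholm B nrm ((*) (poly p)) \<and> N = (*) (poly p) ` B"
proof -
  have sub: "cfun.subspace N" and NB: "N \<subseteq> B"
    using fc by (auto simp: finite_codimensional_def)
  have roots: "z \<in> unit_disk" if z: "poly p z = 0" for z
  proof -
    obtain p1 where p1: "p = [:- z, 1:] * p1" using z poly_eq_0_iff_dvd dvdE by metis
    have "cmod z \<le> 1"
      using no_root_outside[of z p1 N] range generator_quotient_notin[OF p p1] p1 by simp
    then show ?thesis using nz[of z] z by (auto simp: order_le_less)
  qed
  have "N \<subseteq> (*) (poly p) ` B"
  proof
    fix f assume f: "f \<in> N"
    then obtain g r where g: "g \<in> B" "f = poly p * g + disk_poly r"
      and r: "r = 0 \<or> degree r < degree p"
      using divide_poly[OF p(1) roots] NB by blast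
    have "disk_poly r = f - poly p * g" using g(2) by simp
    moreover have "poly p * g \<in> N" using range g(1) by blast
    ultimately have "disk_poly r \<in> N" using cfun.subspace_diff[OF sub f] by simp
    then have "r = 0" using p(2)[of r] r by fastforce
    then have "f = poly p * g" using g(2) by (simp only: disk_poly_0 add_0_right)
    then show "f \<in> (*) (poly p) ` B" using g(1) by blast
  qed
  then have "N = (*) (poly p) ` B" using range by blast
  then show ?thesis using fredholm_poly[OF p(1)] fc closed by simp
qed

end

section \<open>The two cases of the boundary-extension type\<close>

theorem corollary3p14:
  fixes B :: "(complex \<Rightarrow> complex) set" and nrm :: "(complex \<Rightarrow> complex) \<Rightarrow> real"
  assumes "admissible_space B nrm"
  shows
    "(boundary_extension_type B nrm 0 \<longrightarrow>
       (\<forall>N. finite_codimensional B N \<and> closedin (norm_top B nrm) N \<longrightarrow>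
          ((*) (\<lambda>z. z) ` N \<subseteq> N \<longleftrightarrow>
           (\<exists>\<psi>. multiplier B \<psi> \<and> fredholm B nrm ((*) \<psi>) \<and> N = (*) \<psi> ` B))))
     \<and>
     ((\<exists>n>0. boundary_extension_type B nrm n) \<longrightarrow>
       (\<forall>N. finite_codimensional B N \<and> closedin (norm_top B nrm) N \<and> (*) (\<lambda>z. z) ` N \<subseteq> N \<longrightarrow>
          ((\<exists>p. multiplier B (poly p) \<and> fredholm B nrm ((*) (poly p)) \<and>
                N = (*) (poly p) ` B \<and> bounded_away_near_boundary (poly p)) \<or>
           (\<exists>p. multiplier B (poly p) \<and> \<not> bounded_away_near_boundary (poly p) \<and>
                N = norm_top B nrm closure_of ((*) (poly p) ` B))) \<and>
          (\<forall>p. multiplier B (poly p) \<and> fredholm B nrm ((*) (poly p)) \<and>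
               N = (*) (poly p) ` B \<longrightarrow> bounded_away_near_boundary (poly p))))"
proof -
  interpret admissible B nrm by unfold_locales (rule assms)
  have part_a: "(*) (\<lambda>z. z) ` N \<subseteq> N \<longleftrightarrow>
      (\<exists>\<psi>. multiplier B \<psi> \<and> fredholm B nrm ((*) \<psi>) \<and> N = (*) \<psi> ` B)"
    if type: "boundary_extension_type B nrm 0"
      and fc: "finite_codimensional B N" and closed: "closedin (norm_top B nrm) N" for N
  proof
    assume inv: "(*) (\<lambda>z. z) ` N \<subseteq> N"
    obtain p where p: "p \<noteq> 0" "\<And>q. disk_poly q \<in> N \<Longrightarrow> q \<noteq> 0 \<Longrightarrow> degree p \<le> degree q"
      and range: "(*) (poly p) ` B \<subseteq> N"
      using invariant_subspace_generator(1)[OF fc closed inv] by blast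
    \<comment> \<open>Type 0 allows a factor vanishing on the circle to be cancelled, against
      minimality of \<open>p\<close>.\<close>
    have nz: "poly p \<zeta> \<noteq> 0" if \<zeta>: "\<zeta> \<in> sphere 0 1" for \<zeta>
    proof
      assume "poly p \<zeta> = 0"
      then obtain p1 where p1: "p = [:- \<zeta>, 1:] * p1" using poly_eq_0_iff_dvd dvdE by metis
      show False
        using no_root_sphere[OF type closed range[unfolded p1] generator_quotient_notin[OF p p1]] \<zeta>
        by blast
    qed
    have "fredholm B nrm ((*) (poly p)) \<and> N = (*) (poly p) ` B"
      by (rule fredholm_range_if_no_boundary_root[OF fc closed p range nz])
    then show "\<exists>\<psi>. multiplier B \<psi> \<and> fredholm B nrm ((*) \<psi>) \<and> N = (*) \<psi> ` B"
      using multiplier_poly by blast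
  next
    assume "\<exists>\<psi>. multiplier B \<psi> \<and> fredholm B nrm ((*) \<psi>) \<and> N = (*) \<psi> ` B"
    then obtain \<psi> where "N = (*) \<psi> ` B" by blast
    then show "(*) (\<lambda>z. z) ` N \<subseteq> N" using range_invariant[of \<psi>] by (simp only:)
  qed
  have part_b: "(\<exists>p. multiplier B (poly p) \<and> fredholm B nrm ((*) (poly p)) \<and>
        N = (*) (poly p) ` B \<and> bounded_away_near_boundary (poly p)) \<or>
      (\<exists>p. multiplier B (poly p) \<and> \<not> bounded_away_near_boundary (poly p) \<and>
        N = norm_top B nrm closure_of ((*) (poly p) ` B))"
    if fc: "finite_codimensional B N" and closed: "closedin (norm_top B nrm) N"
      and inv: "(*) (\<lambda>z. z) ` N \<subseteq> N" for N
  proof -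
    obtain p where p: "p \<noteq> 0" "\<And>q. disk_poly q \<in> N \<Longrightarrow> q \<noteq> 0 \<Longrightarrow> degree p \<le> degree q"
      and range: "(*) (poly p) ` B \<subseteq> N"
      and N: "N = norm_top B nrm closure_of ((*) (poly p) ` B)"
      using invariant_subspace_generator(1)[OF fc closed inv] by blast
    \<comment> \<open>Without zeros on the circle the range is already closed and equals
      \<open>N\<close>; otherwise \<open>N\<close> is still its closure.\<close>
    show ?thesis
    proof (cases "bounded_away_near_boundary (poly p)")
      case True
      then have nz: "\<And>\<zeta>. \<zeta> \<in> sphere 0 1 \<Longrightarrow> poly p \<zeta> \<noteq> 0"
        using bounded_away_near_boundary_poly_iff by blast
      have "fredholm B nrm ((*) (poly p)) \<and> N = (*) (poly p) ` B"
        by (rule fredholm_range_if_no_boundary_root[OF fc closed p range nz])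
      then show ?thesis using multiplier_poly True by blast
    next
      case False
      then show ?thesis using multiplier_poly N by blast
    qed
  qed
  \<comment> \<open>The bound near the boundary is shown for every polynomial symbol with range
    \<open>N\<close>, not only for the minimal generator.\<close>
  have part_b': "bounded_away_near_boundary (poly p)"
    if "boundary_extension_type B nrm n" "n > 0"
      and "finite_codimensional B N" "closedin (norm_top B nrm) N" "N = (*) (poly p) ` B" for n N p
    unfolding bounded_away_near_boundary_poly_iff
    using that closed_range_no_boundary_root by blast
  show ?thesis
    by (intro conjI impI allI; elim exE conjE)
      ((rule part_a part_b part_b'; assumption)+)
qed

end
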